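(* Let $(X,\delta)$ be a sober approach space. (i) For each proper open $[0,\infty]$-filter $\Lambda$ of $(\mathfrak{U}X,\rho_X)$, there is a unique inhabited compact saturated function $\nu$ of $(X,\delta)$ such that $\Lambda=\rho_X(\nu,-)$ on $\mathfrak{U}X$. (ii) For each decent open $[0,\infty]$-filter $\Lambda$ of $(\mathfrak{U}X,\rho_X)$, there is a unique non-vacuous compact saturated function $\mu$ of $(X,\delta)$ such that $\Lambda=\rho_X(\mu,-)$ on $\mathfrak{U}X$. Therefore, the assignment $\theta\mapsto\rho_X(\theta,-)$ is a bijection from the set of inhabited (respectively, non-vacuous) compact saturated functions of $(X,\delta)$ to the set of proper (respectively, decent) open $[0,\infty]$-filters of $(\mathfrak{U}X,\rho_X)$. Furthermore, in each of the two cases this bijection is an isomorphism of metric spaces between the opposite of the metric space of these compact saturated functions (with metric $\rho_X$) and the metric space of these open $[0,\infty]$-filters (with metric $\rho_{\mathfrak{U}X}$); that is, $\rho_X(\theta,\lambda)=\rho_{\mathfrak{U}X}(\rho_X(\lambda,-),\rho_X(\theta,-))$ for all such functions $\theta,\lambda$.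
   Context: Conventions on $[0,\infty]$ (usual order): $a\ominus b=\max\{0,a-b\}$ is the least $c$ with $a\le b+c$ (so $\infty\ominus\infty=0$, $a\ominus\infty=0$, $\infty\ominus b=\infty$ for $b<\infty$); $\inf\varnothing=\infty$, $\sup\varnothing=0$. Orders, infima and suprema of $[0,\infty]$-valued functions are pointwise for the usual order. Metric spaces: a metric space is a set $X$ with $d\colon X\times X\to[0,\infty]$ such that $d(x,x)=0$ and $d(x,y)+d(y,z)\ge d(x,z)$ (no symmetry, separatedness or finiteness assumed). Its opposite is $d^{\rm op}(x,y)=d(y,x)$. A map $f$ is non-expansive if $d_X(x,y)\ge d_Y(f(x),f(y))$. Put $d_L(a,b)=b\ominus a$ on $[0,\infty]$. For a set $X$, $\rho_X(\lambda,\mu)=\sup_{x\in X}(\mu(x)\ominus\lambda(x))$ is a metric on $[0,\infty]^X$; every subset of $[0,\infty]^X$ carries the restricted metric, again denoted $\rho_X$. In particular sets of maps $\mathfrak{U}X\to[0,\infty]$ carry $\rho_{\mathfrak{U}X}$. Filters: a weight of $(X,d)$ is $\phi\colon X\to[0,\infty]$ with $\phi(y)+d(x,y)\ge\phi(x)$ for all $x,y$. An element $a$ is a colimit of a weight $\phi$ if $d(a,y)=\rho_X(\phi,d(-,y))$ for all $y$. A net $\{x_i\}$ is forward Cauchy if $\inf_i\sup_{k\ge j\ge i}d(x_j,x_k)=0$. A $[0,\infty]$-ideal of $(X,d)$ is a weight of the form $\inf_i\sup_{j\ge i}d(-,x_j)$ for a forward Cauchy net $\{x_i\}$. A $[0,\infty]$-filter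 of $(X,d)$ is a $[0,\infty]$-ideal of $(X,d^{\rm op})$. A non-expansive map $f\colon(X,d_X)\to(Y,d_Y)$ is $[0,\infty]$-Scott continuous if for each $[0,\infty]$-ideal $\phi$ of $(X,d_X)$ having a colimit $a$, $f(a)$ is a colimit of the weight $y\mapsto\inf_{x\in X}(\phi(x)+d_Y(y,f(x)))$. A $[0,\infty]$-filter $\lambda$ of $(X,d)$ is open if $\lambda\colon(X,d)\to([0,\infty],d_L)$ is $[0,\infty]$-Scott continuous. Approach spaces: an approach space is a set $X$ with $\delta\colon X\times2^X\to[0,\infty]$ such that for all $x\in X$, $A,B\subseteq X$: $\delta(x,\{x\})=0$; $\delta(x,\varnothing)=\infty$; $\delta(x,A\cup B)=\min\{\delta(x,A),\delta(x,B)\}$; $\delta(x,A)\le\big(\sup_{b\in B}\delta(b,A)\big)+\delta(x,B)$. A map $f\colon(X,\delta_X)\to(Y,\delta_Y)$ is continuous if $\delta_X(x,A)\ge\delta_Y(f(x),f(A))$ always. $\mathbb P$ is $[0,\infty]$ with $\delta_{\mathbb P}(x,A)=x\ominus\sup A$ for $A\ne\varnothing$ and $\delta_{\mathbb P}(x,\varnothing)=\infty$. $\mathfrak{L}X$ is the set of lower regular functions of $(X,\delta)$, i.e. continuous maps $(X,\delta)\to\mathbb P$. $\infty_X$ is the constant function $\infty$, and $r_X$ the constant function $r$. $\mathfrak{U}X$ is the set of upper regular functions: those $\lambda\in[0,\infty]^X$ such that either $\lambda=\infty_X$, or $\lambda$ is bounded (i.e. $\sup_x\lambda(x)<\infty$)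 and $r\ominus\lambda\in\mathfrak{L}X$ for all $r\in[0,\infty]$. A function $\theta\colon X\to[0,\infty]$ is compact if $\rho_X(\theta,-)\colon\mathfrak{U}X\to[0,\infty]$ is an open $[0,\infty]$-filter of $(\mathfrak{U}X,\rho_X)$; saturated if $\delta(x,\{y\})+\theta(x)\ge\theta(y)$ for all $x,y\in X$; inhabited if $\inf_{x\in X}\theta(x)=0$; vacuous if $\theta=\infty_X$. A lower regular function $\phi$ is irreducible if for all $\phi_1,\phi_2\in\mathfrak{L}X$, $\inf\{\phi_1,\phi_2\}\le\phi$ implies $\phi_1\le\phi$ or $\phi_2\le\phi$. $(X,\delta)$ is sober if for each inhabited irreducible lower regular function $\phi$ there is a unique $x\in X$ with $\phi=\delta(-,\{x\})$. A $[0,\infty]$-filter $\Lambda$ of $(\mathfrak{U}X,\rho_X)$ is proper if $\Lambda(r_X)=r$ for each $r\in[0,\infty]$, and decent if $\Lambda(\lambda)\ne0$ for some $\lambda\in\mathfrak{U}X$ with $\lambda\ne\infty_X$. *)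

theory Defs
  imports "HOL-Library.Extended_Nonnegative_Real" "HOL-Library.FuncSet"
begin

text \<open>
  All structures live on carrier sets, which may be empty. A function on a set \<open>X\<close> with values in
  the extended non-negative reals is an element of \<open>X \<rightarrow>\<^sub>E UNIV\<close>, so that equality of such
  elements is equality on \<open>X\<close>.
\<close>

section \<open>Truncated subtraction\<close>

text \<open>
  The subtraction of \<^typ>\<open>ennreal\<close> has \<open>\<infinity> - \<infinity> = \<infinity>\<close>, so it is corrected at that point.
\<close>

definition ominus :: "ennreal \<Rightarrow> ennreal \<Rightarrow> ennreal"  (infixl "\<ominus>" 65)
  where "a \<ominus> b = (if a \<le> b then 0 else a - b)"

lemma ominus_le_iff: "a \<ominus> b \<le> c \<longleftrightarrow> a \<le> b + c"
proof (cases "a \<le> b")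
  case True
  then show ?thesis by (auto simp: ominus_def intro: order_trans add_increasing2)
next
  case False
  then have "b \<noteq> top" by auto
  with False show ?thesis
    by (auto simp: ominus_def ennreal_minus_le_iff)
qed

section \<open>Metric spaces\<close>

definition is_metric :: "'a set \<Rightarrow> ('a \<Rightarrow> 'a \<Rightarrow> ennreal) \<Rightarrow> bool"
  where "is_metric X d \<longleftrightarrow>
    (\<forall>x\<in>X. d x x = 0) \<and> (\<forall>x\<in>X. \<forall>y\<in>X. \<forall>z\<in>X. d x y + d y z \<ge> d x z)"

definition op_metric :: "('a \<Rightarrow> 'a \<Rightarrow> ennreal) \<Rightarrow> 'a \<Rightarrow> 'a \<Rightarrow> ennreal"
  where "op_metric d x y = d y x"

definition non_expansive ::
    "'a set \<Rightarrow> ('a \<Rightarrow> 'a \<Rightarrow> ennreal) \<Rightarrow> 'b set \<Rightarrow> ('b \<Rightarrow> 'b \<Rightarrow> ennreal) \<Rightarrow> ('a \<Rightarrow> 'b) \<Rightarrow> bool"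
  where "non_expansive X dX Y dY f \<longleftrightarrow>
    f \<in> X \<rightarrow> Y \<and> (\<forall>x\<in>X. \<forall>y\<in>X. dX x y \<ge> dY (f x) (f y))"

definition metric_iso ::
    "'a set \<Rightarrow> ('a \<Rightarrow> 'a \<Rightarrow> ennreal) \<Rightarrow> 'b set \<Rightarrow> ('b \<Rightarrow> 'b \<Rightarrow> ennreal) \<Rightarrow> ('a \<Rightarrow> 'b) \<Rightarrow> bool"
  where "metric_iso X dX Y dY f \<longleftrightarrow>
    is_metric X dX \<and> is_metric Y dY \<and> bij_betw f X Y \<and>
    (\<forall>x\<in>X. \<forall>y\<in>X. dX x y = dY (f x) (f y))"

definition dL :: "ennreal \<Rightarrow> ennreal \<Rightarrow> ennreal"
  where "dL a b = b \<ominus> a"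

definition rho :: "'a set \<Rightarrow> ('a \<Rightarrow> ennreal) \<Rightarrow> ('a \<Rightarrow> ennreal) \<Rightarrow> ennreal"
  where "rho X l m = (SUP x\<in>X. m x \<ominus> l x)"

definition const_fun :: "'a set \<Rightarrow> ennreal \<Rightarrow> 'a \<Rightarrow> ennreal"
  where "const_fun X r = (\<lambda>x\<in>X. r)"

section \<open>Ideals and filters\<close>

definition weight :: "'a set \<Rightarrow> ('a \<Rightarrow> 'a \<Rightarrow> ennreal) \<Rightarrow> ('a \<Rightarrow> ennreal) \<Rightarrow> bool"
  where "weight X d \<phi> \<longleftrightarrow>
    \<phi> \<in> X \<rightarrow>\<^sub>E UNIV \<and> (\<forall>x\<in>X. \<forall>y\<in>X. \<phi> y + d x y \<ge> \<phi> x)"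

definition is_colimit ::
    "'a set \<Rightarrow> ('a \<Rightarrow> 'a \<Rightarrow> ennreal) \<Rightarrow> ('a \<Rightarrow> ennreal) \<Rightarrow> 'a \<Rightarrow> bool"
  where "is_colimit X d \<phi> a \<longleftrightarrow>
    a \<in> X \<and> (\<forall>y\<in>X. d a y = rho X \<phi> (\<lambda>x. d x y))"

definition directed_set :: "'i set \<Rightarrow> ('i \<Rightarrow> 'i \<Rightarrow> bool) \<Rightarrow> bool"
  where "directed_set I le \<longleftrightarrow>
    I \<noteq> {} \<and> (\<forall>i\<in>I. le i i) \<and>
    (\<forall>i\<in>I. \<forall>j\<in>I. \<forall>k\<in>I. le i j \<longrightarrow> le j k \<longrightarrow> le i k) \<and>
    (\<forall>i\<in>I. \<forall>j\<in>I. \<exists>k\<in>I. le i k \<and> le j k)"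

definition forward_cauchy ::
    "'a set \<Rightarrow> ('a \<Rightarrow> 'a \<Rightarrow> ennreal) \<Rightarrow> 'i set \<Rightarrow> ('i \<Rightarrow> 'i \<Rightarrow> bool) \<Rightarrow> ('i \<Rightarrow> 'a) \<Rightarrow> bool"
  where "forward_cauchy X d I le x \<longleftrightarrow>
    directed_set I le \<and> x \<in> I \<rightarrow> X \<and>
    (INF i\<in>I. SUP j\<in>{j\<in>I. le i j}. SUP k\<in>{k\<in>I. le j k}. d (x j) (x k)) = 0"

definition net_weight ::
    "'a set \<Rightarrow> ('a \<Rightarrow> 'a \<Rightarrow> ennreal) \<Rightarrow> 'i set \<Rightarrow> ('i \<Rightarrow> 'i \<Rightarrow> bool) \<Rightarrow> ('i \<Rightarrow> 'a) \<Rightarrow> 'a \<Rightarrow> ennreal"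
  where "net_weight X d I le x = (\<lambda>y\<in>X. INF i\<in>I. SUP j\<in>{j\<in>I. le i j}. d y (x j))"

text \<open>
  A definition cannot quantify over the index types of nets, so the index type is fixed here.
  Lemma \<open>net_weight_ideal\<close> below shows that nets over arbitrary index types give no further ideals.
\<close>

definition is_ideal :: "'a set \<Rightarrow> ('a \<Rightarrow> 'a \<Rightarrow> ennreal) \<Rightarrow> ('a \<Rightarrow> ennreal) \<Rightarrow> bool"
  where "is_ideal X d \<phi> \<longleftrightarrow>
    weight X d \<phi> \<and>
    (\<exists>(I :: ('a \<times> ennreal) set) le x. forward_cauchy X d I le x \<and> \<phi> = net_weight X d I le x)"

definition is_filter :: "'a set \<Rightarrow> ('a \<Rightarrow> 'a \<Rightarrow> ennreal) \<Rightarrow> ('a \<Rightarrow> ennreal) \<Rightarrow> bool"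
  where "is_filter X d \<phi> \<longleftrightarrow> is_ideal X (op_metric d) \<phi>"

definition scott_continuous ::
    "'a set \<Rightarrow> ('a \<Rightarrow> 'a \<Rightarrow> ennreal) \<Rightarrow> 'b set \<Rightarrow> ('b \<Rightarrow> 'b \<Rightarrow> ennreal) \<Rightarrow> ('a \<Rightarrow> 'b) \<Rightarrow> bool"
  where "scott_continuous X dX Y dY f \<longleftrightarrow>
    non_expansive X dX Y dY f \<and>
    (\<forall>\<phi> a. is_ideal X dX \<phi> \<longrightarrow> is_colimit X dX \<phi> a \<longrightarrow>
       is_colimit Y dY (\<lambda>y\<in>Y. INF x\<in>X. \<phi> x + dY y (f x)) (f a))"

definition open_filter :: "'a set \<Rightarrow> ('a \<Rightarrow> 'a \<Rightarrow> ennreal) \<Rightarrow> ('a \<Rightarrow> ennreal) \<Rightarrow> bool"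
  where "open_filter X d \<phi> \<longleftrightarrow> is_filter X d \<phi> \<and> scott_continuous X d UNIV dL \<phi>"

section \<open>Approach spaces\<close>

definition approach_space :: "'a set \<Rightarrow> ('a \<Rightarrow> 'a set \<Rightarrow> ennreal) \<Rightarrow> bool"
  where "approach_space X \<delta> \<longleftrightarrow>
    (\<forall>x\<in>X. \<delta> x {x} = 0) \<and>
    (\<forall>x\<in>X. \<delta> x {} = \<infinity>) \<and>
    (\<forall>x\<in>X. \<forall>A B. A \<subseteq> X \<longrightarrow> B \<subseteq> X \<longrightarrow> \<delta> x (A \<union> B) = min (\<delta> x A) (\<delta> x B)) \<and>
    (\<forall>x\<in>X. \<forall>A B. A \<subseteq> X \<longrightarrow> B \<subseteq> X \<longrightarrow> \<delta> x A \<le> (SUP b\<in>B. \<delta> b A) + \<delta> x B)"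

definition approach_continuous ::
    "'a set \<Rightarrow> ('a \<Rightarrow> 'a set \<Rightarrow> ennreal) \<Rightarrow> 'b set \<Rightarrow> ('b \<Rightarrow> 'b set \<Rightarrow> ennreal) \<Rightarrow> ('a \<Rightarrow> 'b) \<Rightarrow> bool"
  where "approach_continuous X \<delta>X Y \<delta>Y f \<longleftrightarrow>
    f \<in> X \<rightarrow> Y \<and> (\<forall>x\<in>X. \<forall>A. A \<subseteq> X \<longrightarrow> \<delta>X x A \<ge> \<delta>Y (f x) (f ` A))"

definition delta_P :: "ennreal \<Rightarrow> ennreal set \<Rightarrow> ennreal"
  where "delta_P x A = (if A = {} then \<infinity> else x \<ominus> Sup A)"

definition lower_regular :: "'a set \<Rightarrow> ('a \<Rightarrow> 'a set \<Rightarrow> ennreal) \<Rightarrow> ('a \<Rightarrow> ennreal) set"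
  where "lower_regular X \<delta> =
    {\<phi> \<in> X \<rightarrow>\<^sub>E UNIV. approach_continuous X \<delta> UNIV delta_P \<phi>}"

definition upper_regular :: "'a set \<Rightarrow> ('a \<Rightarrow> 'a set \<Rightarrow> ennreal) \<Rightarrow> ('a \<Rightarrow> ennreal) set"
  where "upper_regular X \<delta> =
    {l \<in> X \<rightarrow>\<^sub>E UNIV. l = const_fun X \<infinity> \<or>
       ((SUP x\<in>X. l x) < \<infinity> \<and> (\<forall>r. (\<lambda>x\<in>X. r \<ominus> l x) \<in> lower_regular X \<delta>))}"

text \<open>\<open>\<rho>\<^sub>X(\<theta>, -)\<close> as a function on the set of upper regular functions.\<close>

definition rho_from ::
    "'a set \<Rightarrow> ('a \<Rightarrow> 'a set \<Rightarrow> ennreal) \<Rightarrow> ('a \<Rightarrow> ennreal) \<Rightarrow> ('a \<Rightarrow> ennreal) \<Rightarrow> ennreal"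
  where "rho_from X \<delta> \<theta> = (\<lambda>l\<in>upper_regular X \<delta>. rho X \<theta> l)"

definition compact_fun :: "'a set \<Rightarrow> ('a \<Rightarrow> 'a set \<Rightarrow> ennreal) \<Rightarrow> ('a \<Rightarrow> ennreal) \<Rightarrow> bool"
  where "compact_fun X \<delta> \<theta> \<longleftrightarrow>
    \<theta> \<in> X \<rightarrow>\<^sub>E UNIV \<and> open_filter (upper_regular X \<delta>) (rho X) (rho_from X \<delta> \<theta>)"

definition saturated_fun :: "'a set \<Rightarrow> ('a \<Rightarrow> 'a set \<Rightarrow> ennreal) \<Rightarrow> ('a \<Rightarrow> ennreal) \<Rightarrow> bool"
  where "saturated_fun X \<delta> \<theta> \<longleftrightarrow>
    \<theta> \<in> X \<rightarrow>\<^sub>E UNIV \<and> (\<forall>x\<in>X. \<forall>y\<in>X. \<delta> x {y} + \<theta> x \<ge> \<theta> y)"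

definition inhabited_fun :: "'a set \<Rightarrow> ('a \<Rightarrow> ennreal) \<Rightarrow> bool"
  where "inhabited_fun X \<theta> \<longleftrightarrow> (INF x\<in>X. \<theta> x) = 0"

definition vacuous_fun :: "'a set \<Rightarrow> ('a \<Rightarrow> ennreal) \<Rightarrow> bool"
  where "vacuous_fun X \<theta> \<longleftrightarrow> \<theta> = const_fun X \<infinity>"

definition irreducible_fun :: "'a set \<Rightarrow> ('a \<Rightarrow> 'a set \<Rightarrow> ennreal) \<Rightarrow> ('a \<Rightarrow> ennreal) \<Rightarrow> bool"
  where "irreducible_fun X \<delta> \<phi> \<longleftrightarrow>
    \<phi> \<in> lower_regular X \<delta> \<and>
    (\<forall>\<phi>1\<in>lower_regular X \<delta>. \<forall>\<phi>2\<in>lower_regular X \<delta>.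
       (\<forall>x\<in>X. min (\<phi>1 x) (\<phi>2 x) \<le> \<phi> x) \<longrightarrow>
       (\<forall>x\<in>X. \<phi>1 x \<le> \<phi> x) \<or> (\<forall>x\<in>X. \<phi>2 x \<le> \<phi> x))"

definition sober :: "'a set \<Rightarrow> ('a \<Rightarrow> 'a set \<Rightarrow> ennreal) \<Rightarrow> bool"
  where "sober X \<delta> \<longleftrightarrow>
    (\<forall>\<phi>. inhabited_fun X \<phi> \<longrightarrow> irreducible_fun X \<delta> \<phi> \<longrightarrow>
       (\<exists>!x. x \<in> X \<and> \<phi> = (\<lambda>y\<in>X. \<delta> y {x})))"

definition proper_filter ::
    "'a set \<Rightarrow> ('a \<Rightarrow> 'a set \<Rightarrow> ennreal) \<Rightarrow> (('a \<Rightarrow> ennreal) \<Rightarrow> ennreal) \<Rightarrow> bool"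
  where "proper_filter X \<delta> \<Lambda> \<longleftrightarrow>
    is_filter (upper_regular X \<delta>) (rho X) \<Lambda> \<and> (\<forall>r. \<Lambda> (const_fun X r) = r)"

definition decent_filter ::
    "'a set \<Rightarrow> ('a \<Rightarrow> 'a set \<Rightarrow> ennreal) \<Rightarrow> (('a \<Rightarrow> ennreal) \<Rightarrow> ennreal) \<Rightarrow> bool"
  where "decent_filter X \<delta> \<Lambda> \<longleftrightarrow>
    is_filter (upper_regular X \<delta>) (rho X) \<Lambda> \<and>
    (\<exists>l\<in>upper_regular X \<delta>. l \<noteq> const_fun X \<infinity> \<and> \<Lambda> l \<noteq> 0)"

definition proper_open_filters ::
    "'a set \<Rightarrow> ('a \<Rightarrow> 'a set \<Rightarrow> ennreal) \<Rightarrow> (('a \<Rightarrow> ennreal) \<Rightarrow> ennreal) set"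
  where "proper_open_filters X \<delta> =
    {\<Lambda>. proper_filter X \<delta> \<Lambda> \<and> open_filter (upper_regular X \<delta>) (rho X) \<Lambda>}"

definition decent_open_filters ::
    "'a set \<Rightarrow> ('a \<Rightarrow> 'a set \<Rightarrow> ennreal) \<Rightarrow> (('a \<Rightarrow> ennreal) \<Rightarrow> ennreal) set"
  where "decent_open_filters X \<delta> =
    {\<Lambda>. decent_filter X \<delta> \<Lambda> \<and> open_filter (upper_regular X \<delta>) (rho X) \<Lambda>}"

definition inhabited_compact_saturated ::
    "'a set \<Rightarrow> ('a \<Rightarrow> 'a set \<Rightarrow> ennreal) \<Rightarrow> ('a \<Rightarrow> ennreal) set"
  where "inhabited_compact_saturated X \<delta> =
    {\<theta>. inhabited_fun X \<theta> \<and> compact_fun X \<delta> \<theta> \<and> saturated_fun X \<delta> \<theta>}"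

definition nonvacuous_compact_saturated ::
    "'a set \<Rightarrow> ('a \<Rightarrow> 'a set \<Rightarrow> ennreal) \<Rightarrow> ('a \<Rightarrow> ennreal) set"
  where "nonvacuous_compact_saturated X \<delta> =
    {\<theta>. \<not> vacuous_fun X \<theta> \<and> compact_fun X \<delta> \<theta> \<and> saturated_fun X \<delta> \<theta>}"

section \<open>Consistency of the definitions\<close>

lemma is_metric_rho: "is_metric S (rho X)"
proof -
  have "m x \<ominus> k x \<le> rho X k l + rho X l m" if "x \<in> X" for k l m :: "'a \<Rightarrow> ennreal" and x
  proof -
    have "l x \<ominus> k x \<le> rho X k l" "m x \<ominus> l x \<le> rho X l m"
      unfolding rho_def using that by (auto intro: SUP_upper)
    then have "l x \<le> k x + rho X k l" "m x \<le> l x + rho X l m"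
      by (simp_all add: ominus_le_iff)
    then have "m x \<le> (k x + rho X k l) + rho X l m"
      by (rule order_trans[OF _ add_right_mono, rotated])
    then have "m x \<le> k x + (rho X k l + rho X l m)"
      by (simp add: add.assoc)
    then show ?thesis by (simp add: ominus_le_iff)
  qed
  then have tri: "rho X k m \<le> rho X k l + rho X l m" for k l m :: "'a \<Rightarrow> ennreal"
    by (subst (1) rho_def) (auto intro: SUP_least)
  have "rho X k k = 0" for k :: "'a \<Rightarrow> ennreal"
  proof -
    have "rho X k k \<le> 0" unfolding rho_def by (rule SUP_least) (simp add: ominus_def)
    then show ?thesis by simp
  qed
  with tri show ?thesis by (simp add: is_metric_def)
qed

lemma net_weight_bound:
  assumes "y \<in> X" "net_weight X d I le x y < r"
  obtains i s where "i \<in> I" "s < r" "\<And>j. j \<in> I \<Longrightarrow> le i j \<Longrightarrow> d y (x j) \<le> s"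
proof -
  from assms obtain i where i: "i \<in> I" "(SUP j\<in>{j\<in>I. le i j}. d y (x j)) < r"
    by (auto simp: net_weight_def INF_less_iff)
  then show ?thesis
    by (intro that[of i "SUP j\<in>{j\<in>I. le i j}. d y (x j)"]) (auto intro: SUP_upper)
qed

lemma forward_cauchy_bound:
  assumes "forward_cauchy X d I le x" "0 < (e::ennreal)"
  obtains i where "i \<in> I"
    "\<And>j k. j \<in> I \<Longrightarrow> k \<in> I \<Longrightarrow> le i j \<Longrightarrow> le j k \<Longrightarrow> d (x j) (x k) \<le> e"
proof -
  from assms have "(INF i\<in>I. SUP j\<in>{j\<in>I. le i j}. SUP k\<in>{k\<in>I. le j k}. d (x j) (x k)) < e"
    by (simp add: forward_cauchy_def)
  then obtain i where i: "i \<in> I"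
    "(SUP j\<in>{j\<in>I. le i j}. SUP k\<in>{k\<in>I. le j k}. d (x j) (x k)) < e"
    by (auto simp: INF_less_iff)
  have "d (x j) (x k) \<le> e" if "j \<in> I" "k \<in> I" "le i j" "le j k" for j k
  proof -
    have "d (x j) (x k) \<le> (SUP k\<in>{k\<in>I. le j k}. d (x j) (x k))"
      using that by (intro SUP_upper) auto
    also have "\<dots> \<le> (SUP j\<in>{j\<in>I. le i j}. SUP k\<in>{k\<in>I. le j k}. d (x j) (x k))"
      using that by (intro SUP_upper) auto
    finally show ?thesis using i(2) by simp
  qed
  with i(1) show ?thesis by (rule that)
qed

lemma weight_net_weight:
  assumes "is_metric X d" "directed_set I le" "x \<in> I \<rightarrow> X"
  shows "weight X d (net_weight X d I le x)"
proof -
  have "net_weight X d I le x y \<le> net_weight X d I le x z + d y z" if yz: "y \<in> X" "z \<in> X" for y z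
  proof (rule ccontr)
    let ?w = "net_weight X d I le x"
    assume "\<not> ?thesis"
    then have lt: "?w z + d y z < ?w y" by simp
    have fin: "d y z \<noteq> top" "?w z \<noteq> top" using lt by (auto simp: top_unique)
    have "?w z < ?w y - d y z"
      using lt fin by (simp add: less_diff_eq_ennreal less_top)
    then obtain i s where i: "i \<in> I" "s < ?w y - d y z"
      "\<And>j. j \<in> I \<Longrightarrow> le i j \<Longrightarrow> d z (x j) \<le> s"
      using net_weight_bound[OF yz(2)] by metis
    have "?w y \<le> (SUP j\<in>{j\<in>I. le i j}. d y (x j))"
      using yz(1) i(1) by (auto simp: net_weight_def intro: INF_lower)
    also have "\<dots> \<le> s + d y z"
    proof (rule SUP_least, clarify)
      fix j assume j: "j \<in> I" "le i j"
      have "d y (x j) \<le> d y z + d z (x j)"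
        using assms(1) yz funcset_mem[OF assms(3) j(1)] by (simp add: is_metric_def)
      also have "\<dots> \<le> d y z + s" using i(3)[OF j] by (simp add: add_left_mono)
      finally show "d y (x j) \<le> s + d y z" by (simp add: add.commute)
    qed
    also have "\<dots> < ?w y" using i(2) fin by (simp add: less_diff_eq_ennreal less_top)
    finally show False by simp
  qed
  then show ?thesis by (auto simp: weight_def net_weight_def)
qed

text \<open>
  The index set used for a given net is the set of formal balls \<open>(y, r)\<close> with \<open>\<phi>(y) < r\<close>, where
  \<open>\<phi>\<close> is the weight of the net.
\<close>

lemma net_weight_ideal:
  fixes I :: "'i set"
  assumes m: "is_metric X d" and fc: "forward_cauchy X d I le x"
  shows "is_ideal X d (net_weight X d I le x)"
proof -
  define w where "w = net_weight X d I le x"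
  define J where "J = {(y, r). y \<in> X \<and> w y < r}"
  define L where "L = (\<lambda>(y, r) (z, s). d y z + s \<le> r)"
  have dir: "directed_set I le" and xX: "x \<in> I \<rightarrow> X"
    using fc by (auto simp: forward_cauchy_def)
  have wt: "weight X d w" unfolding w_def by (rule weight_net_weight[OF m dir xX])
  have m0: "d y y = 0" if "y \<in> X" for y using m that by (simp add: is_metric_def)
  have tri: "d y u \<le> d y z + d z u" if "y \<in> X" "z \<in> X" "u \<in> X" for y z u
    using m that by (simp add: is_metric_def)
  have gap: "\<exists>e>0. s + e \<le> r" if "s < r" for s r :: ennreal
  proof (intro exI conjI)
    show "0 < r - s" using that by (simp add: diff_gr0_ennreal)
    show "s + (r - s) \<le> r" using that by (simp add: add_diff_inverse_ennreal)
  qed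
  have half: "\<exists>h>0. h < e" if "0 < e" for e :: ennreal using dense[OF that] by blast
  have small: "\<exists>i\<in>I. \<forall>j\<in>I. le i j \<longrightarrow> w (x j) < e" if "0 < e" for e
  proof -
    obtain h where h: "0 < h" "h < e" using half \<open>0 < e\<close> by blast
    obtain i where i: "i \<in> I"
      "\<And>j k. j \<in> I \<Longrightarrow> k \<in> I \<Longrightarrow> le i j \<Longrightarrow> le j k \<Longrightarrow> d (x j) (x k) \<le> h"
      using forward_cauchy_bound[OF fc h(1)] by metis
    have "w (x j) \<le> h" if "j \<in> I" "le i j" for j
    proof -
      have "w (x j) \<le> (SUP k\<in>{k\<in>I. le j k}. d (x j) (x k))"
        using xX that by (auto simp: w_def net_weight_def intro!: INF_lower)
      also have "\<dots> \<le> h" using i that by (auto intro!: SUP_least)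
      finally show ?thesis .
    qed
    with h(2) have "\<forall>j\<in>I. le i j \<longrightarrow> w (x j) < e" by (auto intro: le_less_trans)
    with i(1) show ?thesis by blast
  qed
  have evt: "\<exists>i\<in>I. \<exists>e>0. \<forall>j\<in>I. le i j \<longrightarrow> d y (x j) + e \<le> r" if "(y, r) \<in> J" for y r
  proof -
    from that have y: "y \<in> X" "w y < r" by (auto simp: J_def)
    obtain i s where i: "i \<in> I" "s < r" "\<And>j. j \<in> I \<Longrightarrow> le i j \<Longrightarrow> d y (x j) \<le> s"
      using net_weight_bound[OF y(1), of d I le x r] y(2) unfolding w_def by metis
    obtain e where "e > 0" "s + e \<le> r" using gap[OF i(2)] by blast
    have "d y (x j) + e \<le> r" if "j \<in> I" "le i j" for j
      using add_right_mono[OF i(3)[OF that], of e] \<open>s + e \<le> r\<close> by (rule order_trans)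
    with i(1) \<open>e > 0\<close> show ?thesis by blast
  qed
  have bound: "\<exists>u t. (u, t) \<in> J \<and> L (y, r) (u, t) \<and> L (z, s) (u, t)"
    if J1: "(y, r) \<in> J" and J2: "(z, s) \<in> J" for y r z s
  proof -
    obtain i1 e1 where 1: "i1 \<in> I" "e1 > 0" "\<forall>j\<in>I. le i1 j \<longrightarrow> d y (x j) + e1 \<le> r"
      using evt[OF J1] by blast
    obtain i2 e2 where 2: "i2 \<in> I" "e2 > 0" "\<forall>j\<in>I. le i2 j \<longrightarrow> d z (x j) + e2 \<le> s"
      using evt[OF J2] by blast
    define e where "e = min e1 e2"
    have "e > 0" using 1 2 by (simp add: e_def)
    then obtain i3 where 3: "i3 \<in> I" "\<forall>j\<in>I. le i3 j \<longrightarrow> w (x j) < e"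
      using small by blast
    obtain k where k: "k \<in> I" "le i1 k" "le i2 k" "le i3 k"
    proof -
      obtain k0 where k0: "k0 \<in> I" "le i1 k0" "le i2 k0"
        using dir 1(1) 2(1) unfolding directed_set_def by blast
      obtain k where k: "k \<in> I" "le k0 k" "le i3 k"
        using dir k0(1) 3(1) unfolding directed_set_def by blast
      have tr: "le i k" if "i \<in> I" "le i k0" for i
        using dir that k0(1) k(1,2) unfolding directed_set_def by blast
      show ?thesis using that k tr[OF 1(1) k0(2)] tr[OF 2(1) k0(3)] by blast
    qed
    have "(x k, e) \<in> J" using k 3 xX by (auto simp: J_def)
    moreover have "d y (x k) + e \<le> r"
      using 1(3) k by (intro order_trans[OF add_left_mono[of e e1]]) (auto simp: e_def)
    moreover have "d z (x k) + e \<le> s"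
      using 2(3) k by (intro order_trans[OF add_left_mono[of e e2]]) (auto simp: e_def)
    ultimately show ?thesis by (auto simp: L_def)
  qed
  have ne: "\<exists>y. (y, e) \<in> J" if "0 < e" for e
  proof -
    obtain i where i: "i \<in> I" "\<forall>j\<in>I. le i j \<longrightarrow> w (x j) < e"
      using small \<open>0 < e\<close> by blast
    have "le i i" using dir i(1) by (simp add: directed_set_def)
    with i have "(x i, e) \<in> J" using funcset_mem[OF xX i(1)] by (simp add: J_def)
    then show ?thesis ..
  qed
  have Ltrans: "L a c" if "a \<in> J" "b \<in> J" "c \<in> J" "L a b" "L b c" for a b c
  proof -
    obtain y r z s u t where [simp]: "a = (y, r)" "b = (z, s)" "c = (u, t)"
      by (metis surj_pair)
    have "d y u + t \<le> (d y z + d z u) + t"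
      using that tri by (auto simp: J_def intro: add_right_mono)
    also have "\<dots> \<le> d y z + s" using that by (auto simp: L_def add.assoc intro: add_left_mono)
    also have "\<dots> \<le> r" using that by (simp add: L_def)
    finally show ?thesis by (simp add: L_def)
  qed
  have dirJ: "directed_set J L"
    unfolding directed_set_def
  proof (intro conjI ballI impI)
    show "J \<noteq> {}" using ne[of 1] by auto
    show "L a a" if "a \<in> J" for a using that m0 by (auto simp: J_def L_def)
    show "L a c" if "a \<in> J" "b \<in> J" "c \<in> J" "L a b" "L b c" for a b c
      using Ltrans that by blast
    show "\<exists>c\<in>J. L a c \<and> L b c" if "a \<in> J" "b \<in> J" for a b
    proof -
      obtain y r z s where [simp]: "a = (y, r)" "b = (z, s)" by (metis surj_pair)
      from bound[of y r z s] that show ?thesis by auto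
    qed
  qed
  have fstJ: "fst \<in> J \<rightarrow> X" by (auto simp: J_def)
  have Lsnd: "snd b \<le> snd a" "d (fst a) (fst b) \<le> snd a" if "L a b" for a b
  proof -
    have *: "d (fst a) (fst b) + snd b \<le> snd a"
      using that by (simp add: L_def split: prod.splits)
    show "snd b \<le> snd a" by (rule order_trans[OF _ *]) simp
    show "d (fst a) (fst b) \<le> snd a" by (rule order_trans[OF _ *]) simp
  qed
  have fcJ: "forward_cauchy X d J L fst"
    unfolding forward_cauchy_def
  proof (intro conjI dirJ fstJ)
    let ?v = "INF i\<in>J. SUP j\<in>{j\<in>J. L i j}. SUP k\<in>{k\<in>J. L j k}. d (fst j) (fst k)"
    have "?v \<le> e" if "0 < e" for e
    proof -
      obtain y where y: "(y, e) \<in> J" using ne \<open>0 < e\<close> by blast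
      have "?v \<le> (SUP j\<in>{j\<in>J. L (y, e) j}. SUP k\<in>{k\<in>J. L j k}. d (fst j) (fst k))"
        by (rule INF_lower[OF y])
      also have "\<dots> \<le> e"
      proof (intro SUP_least, clarsimp)
        fix z s u t assume "L (y, e) (z, s)" "L (z, s) (u, t)"
        from Lsnd(1)[OF this(1)] Lsnd(2)[OF this(2)] show "d z u \<le> e" by simp
      qed
      finally show ?thesis .
    qed
    then have "?v \<le> 0" by (rule dense_ge)
    then show "?v = 0" by simp
  qed
  have "w y = (INF i\<in>J. SUP j\<in>{j\<in>J. L i j}. d y (fst j))" if y: "y \<in> X" for y
  proof (rule antisym)
    show "(INF i\<in>J. SUP j\<in>{j\<in>J. L i j}. d y (fst j)) \<le> w y"
    proof (rule dense_ge)
      fix r assume "w y < r"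
      then have yr: "(y, r) \<in> J" using y by (simp add: J_def)
      have "(INF i\<in>J. SUP j\<in>{j\<in>J. L i j}. d y (fst j)) \<le> (SUP j\<in>{j\<in>J. L (y, r) j}. d y (fst j))"
        by (rule INF_lower[OF yr])
      also have "\<dots> \<le> r" using Lsnd(2)[of "(y, r)"] by (intro SUP_least) auto
      finally show "(INF i\<in>J. SUP j\<in>{j\<in>J. L i j}. d y (fst j)) \<le> r" .
    qed
    show "w y \<le> (INF i\<in>J. SUP j\<in>{j\<in>J. L i j}. d y (fst j))"
    proof (rule INF_greatest)
      fix i assume i: "i \<in> J"
      let ?S = "SUP j\<in>{j\<in>J. L i j}. d y (fst j)"
      show "w y \<le> ?S"
      proof (rule ennreal_le_epsilon)
        fix e :: real assume "0 < e"
        then obtain z where z: "(z, ennreal e) \<in> J" using ne[of "ennreal e"] by auto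
        obtain c where c: "c \<in> J" "L i c" "L (z, ennreal e) c"
          using dirJ i z unfolding directed_set_def by blast
        have "w y \<le> w (fst c) + d y (fst c)"
          using wt y c(1) fstJ unfolding weight_def by auto
        also have "\<dots> \<le> ennreal e + ?S"
        proof (rule add_mono)
          have "w (fst c) \<le> snd c" using c(1) by (auto simp: J_def)
          also have "\<dots> \<le> ennreal e" using Lsnd(1)[OF c(3)] by simp
          finally show "w (fst c) \<le> ennreal e" .
          show "d y (fst c) \<le> ?S" using c by (intro SUP_upper) auto
        qed
        finally show "w y \<le> ?S + ennreal e" by (simp add: add.commute)
      qed
    qed
  qed
  then have "w = net_weight X d J L fst"
    unfolding net_weight_def by (auto simp: w_def net_weight_def fun_eq_iff)
  with fcJ wt show ?thesis unfolding is_ideal_def w_def by blast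
qed

end

theory Submission
  imports Defs
begin

text \<open>
  Given an open filter \<open>\<Lambda>\<close>, the candidate for \<open>\<nu>\<close> is \<open>\<nu>(x) = sup\<^sub>v (v(x) \<ominus> \<Lambda>(v))\<close>, the least function
  with \<open>\<rho>\<^sub>X(\<nu>, v) \<le> \<Lambda>(v)\<close> for all \<open>v\<close>. For the converse inequality at a bounded \<open>u\<close> with
  \<open>\<Lambda>(u) > 0\<close> one needs a point \<open>x\<close> with \<open>\<nu>(x) + \<Lambda>(u) \<le> u(x)\<close>. As in the Hofmann--Mislove theorem
  it comes from Zorn's lemma: openness of \<open>\<Lambda>\<close> makes the lower regular functions \<open>\<phi>\<close> with
  \<open>\<Lambda>(s \<ominus> \<phi>) \<ge> s \<ominus> c\<close> for all finite \<open>s\<close> closed under suprema of chains, the filter property makes a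
  maximal one irreducible, and soberness turns it, after subtracting its infimum, into \<open>\<delta>(-, {x})\<close>.
  The start is \<open>\<phi> = M \<ominus> u\<close> with \<open>M\<close> a bound of \<open>u\<close> and \<open>c = M - \<Lambda>(u)\<close>; it is admissible because
  \<open>\<Lambda>(u + a) = \<Lambda>(u) + a\<close> as soon as \<open>\<Lambda>(u) > 0\<close>. Uniqueness and the isometry hold because a saturated
  function is a supremum of upper regular ones.
\<close>

section \<open>Truncated subtraction and the metric on functions\<close>

lemma ominus_eq_minus: "s < \<infinity> \<Longrightarrow> s \<ominus> y = s - y"
  by (auto simp: ominus_def diff_eq_0_iff_ennreal)

text \<open>Truncated subtraction of \<open>r\<close> is left adjoint to addition of
  \<open>r\<close>, so addition of \<open>r\<close> preserves infima, including the empty infimum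
  \<infinity>.\<close>

lemma le_INF_add_ennreal:
  fixes c r :: ennreal
  assumes "\<And>i. i \<in> I \<Longrightarrow> c \<le> f i + r"
  shows "c \<le> (INF i\<in>I. f i) + r"
proof -
  have "c \<ominus> r \<le> (INF i\<in>I. f i)"
    using assms by (intro INF_greatest) (simp add: ominus_le_iff add.commute)
  then show ?thesis by (simp add: ominus_le_iff add.commute)
qed

lemma rho_le_iff: "rho X l m \<le> c \<longleftrightarrow> (\<forall>x\<in>X. m x \<le> l x + c)"
  by (simp add: rho_def SUP_le_iff ominus_le_iff)

lemma le_add_rho: "x \<in> X \<Longrightarrow> m x \<le> l x + rho X l m"
  using rho_le_iff[of X l m "rho X l m"] by blast

lemma rho_refl [simp]: "rho X l l = 0"
  using is_metric_rho[of "{l}" X] by (simp add: is_metric_def)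

lemma rho_triangle: "rho X k m \<le> rho X k l + rho X l m"
  using is_metric_rho[of UNIV X] by (simp add: is_metric_def)

lemma rho_eq_0: "(\<And>x. x \<in> X \<Longrightarrow> m x \<le> l x) \<Longrightarrow> rho X l m = 0"
  using rho_le_iff[of X l m 0] by simp

lemma rho_const_fun:
  assumes "r < \<infinity>"
  shows "rho X l (const_fun X r) = r \<ominus> (INF x\<in>X. l x)"
proof (cases "X = {}")
  case True
  then show ?thesis by (simp add: rho_def ominus_def bot_ennreal)
next
  case False
  then show ?thesis
    using assms by (simp add: rho_def const_fun_def ominus_eq_minus ennreal_INF_const_minus)
qed

section \<open>Ideals and open filters\<close>

text \<open>At a net point \<open>x i\<close>, the weight of the net is at most the supremum of
  \<open>d (x i) (x k)\<close> over later \<open>k\<close>, which the Cauchy condition makes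
  small.\<close>

lemma ideal_small:
  assumes "is_ideal X d \<phi>" "0 < e"
  obtains w where "w \<in> X" "\<phi> w \<le> e"
proof -
  obtain I :: "('a \<times> ennreal) set" and le x
    where fc: "forward_cauchy X d I le x" and \<phi>: "\<phi> = net_weight X d I le x"
    using assms(1) by (auto simp: is_ideal_def)
  obtain i where i: "i \<in> I"
    "\<And>j k. j \<in> I \<Longrightarrow> k \<in> I \<Longrightarrow> le i j \<Longrightarrow> le j k \<Longrightarrow> d (x j) (x k) \<le> e"
    using forward_cauchy_bound[OF fc assms(2)] by metis
  have "le i i" using fc i(1) unfolding forward_cauchy_def directed_set_def by blast
  have xi: "x i \<in> X" using fc i(1) unfolding forward_cauchy_def by blast
  have "\<phi> (x i) \<le> (SUP k\<in>{k\<in>I. le i k}. d (x i) (x k))"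
    unfolding \<phi> net_weight_def using xi i(1) by simp (rule INF_lower)
  also have "\<dots> \<le> e" by (intro SUP_least i(2)) (use i(1) \<open>le i i\<close> in simp_all)
  finally show thesis using that xi by blast
qed

text \<open>Quantitative directedness: a term of the net beyond three suitable indices is close
  enough to \<open>y\<close> and to \<open>z\<close>, and the Cauchy condition makes the weight
  small there.\<close>

lemma ideal_directed:
  assumes "is_ideal X d \<phi>" "0 < e" "y \<in> X" "z \<in> X" "\<phi> y < r" "\<phi> z < s"
  obtains w where "w \<in> X" "\<phi> w \<le> e" "d y w \<le> r" "d z w \<le> s"
proof -
  obtain I :: "('a \<times> ennreal) set" and le x
    where fc: "forward_cauchy X d I le x" and \<phi>: "\<phi> = net_weight X d I le x"
    using assms(1) by (auto simp: is_ideal_def)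
  obtain i where i: "i \<in> I"
    "\<And>j k. j \<in> I \<Longrightarrow> k \<in> I \<Longrightarrow> le i j \<Longrightarrow> le j k \<Longrightarrow> d (x j) (x k) \<le> e"
    using forward_cauchy_bound[OF fc assms(2)] by metis
  obtain i1 t1 where 1: "i1 \<in> I" "t1 < r" "\<And>j. j \<in> I \<Longrightarrow> le i1 j \<Longrightarrow> d y (x j) \<le> t1"
    using net_weight_bound[OF assms(3), of d I le x r] assms(5) unfolding \<phi> by metis
  obtain i2 t2 where 2: "i2 \<in> I" "t2 < s" "\<And>j. j \<in> I \<Longrightarrow> le i2 j \<Longrightarrow> d z (x j) \<le> t2"
    using net_weight_bound[OF assms(4), of d I le x s] assms(6) unfolding \<phi> by metis
  have dir: "directed_set I le" using fc by (simp add: forward_cauchy_def)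
  obtain k0 where k0: "k0 \<in> I" "le i1 k0" "le i2 k0"
    using dir 1(1) 2(1) unfolding directed_set_def by blast
  obtain k where k: "k \<in> I" "le k0 k" "le i k"
    using dir k0(1) i(1) unfolding directed_set_def by blast
  have tr: "le j k" if "j \<in> I" "le j k0" for j
    using dir that k0(1) k(1,2) unfolding directed_set_def by blast
  have xk: "x k \<in> X" using fc k(1) unfolding forward_cauchy_def by blast
  have "\<phi> (x k) \<le> (SUP j\<in>{j\<in>I. le k j}. d (x k) (x j))"
    unfolding \<phi> net_weight_def using xk k(1) by simp (rule INF_lower)
  also have "\<dots> \<le> e" by (intro SUP_least i(2)) (use k in simp_all)
  finally have "\<phi> (x k) \<le> e" .
  moreover have "d y (x k) \<le> r" "d z (x k) \<le> s"
    using 1(2,3) 2(2,3) tr k0 1(1) 2(1) k(1) by (meson le_less_trans less_imp_le)+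
  ultimately show thesis using that xk by blast
qed

lemma filter_rho:
  assumes "is_filter U (rho X) \<Lambda>" "u \<in> U" "v \<in> U"
  shows "\<Lambda> v \<le> \<Lambda> u + rho X u v"
  using assms by (auto simp: is_filter_def is_ideal_def weight_def op_metric_def)

lemma filter_mono:
  assumes "is_filter U (rho X) \<Lambda>" "u \<in> U" "v \<in> U" "\<And>x. x \<in> X \<Longrightarrow> u x \<le> v x + r"
  shows "\<Lambda> u \<le> \<Lambda> v + r"
proof -
  have "rho X v u \<le> r" using assms(4) by (simp add: rho_le_iff)
  then show ?thesis using filter_rho[OF assms(1,3,2)] by (meson add_left_mono order_trans)
qed

lemma filter_directed:
  assumes "is_filter U (rho X) \<Lambda>" "0 < e" "u \<in> U" "v \<in> U" "\<Lambda> u < r" "\<Lambda> v < r"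
  obtains w where "w \<in> U" "\<Lambda> w \<le> e" "rho X w u \<le> r" "rho X w v \<le> r"
proof -
  have "is_ideal U (op_metric (rho X)) \<Lambda>" using assms(1) by (simp add: is_filter_def)
  then show thesis
    by (rule ideal_directed[of U "op_metric (rho X)" \<Lambda> e u v r r, OF _ assms(2-6)])
      (rule that, simp_all add: op_metric_def)
qed

text \<open>Plays the role of closure under binary intersections. For \<open>r\<close> above both
  values, directedness gives \<open>z\<close> with \<open>\<Lambda> z\<close> near 0 and
  \<open>u\<close>, \<open>v\<close>, hence also \<open>w\<close>, below
  \<open>z + r\<close>.\<close>

lemma filter_max:
  assumes F: "is_filter U (rho X) \<Lambda>" and "u \<in> U" "v \<in> U" "w \<in> U"
    and w: "\<And>x. x \<in> X \<Longrightarrow> w x \<le> max (u x) (v x)"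
  shows "\<Lambda> w \<le> max (\<Lambda> u) (\<Lambda> v)"
proof (rule dense_ge)
  fix r assume "max (\<Lambda> u) (\<Lambda> v) < r"
  then have lt: "\<Lambda> u < r" "\<Lambda> v < r" by auto
  show "\<Lambda> w \<le> r"
  proof (rule ennreal_le_epsilon)
    fix e :: real assume "0 < e"
    then have "0 < ennreal e" by simp
    then obtain z where z: "z \<in> U" "\<Lambda> z \<le> ennreal e" "rho X z u \<le> r" "rho X z v \<le> r"
      by (rule filter_directed[of U X \<Lambda> "ennreal e" u v r, OF F _ assms(2,3) lt])
    have "w x \<le> z x + r" if "x \<in> X" for x
    proof -
      have "u x \<le> z x + r" "v x \<le> z x + r" using z(3,4) that by (simp_all add: rho_le_iff)
      then have "max (u x) (v x) \<le> z x + r" by simp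
      with w[OF that] show ?thesis by (rule order_trans)
    qed
    then have "\<Lambda> w \<le> \<Lambda> z + r" using filter_mono[OF F assms(4) z(1)] by blast
    also have "\<dots> \<le> r + ennreal e" using z(2) by (simp add: add.commute add_left_mono)
    finally show "\<Lambda> w \<le> r + ennreal e" .
  qed
qed

text \<open>If the claim failed, some \<open>r\<close> would lie above \<open>\<Lambda> v\<close>
  and \<open>a\<close> but below \<open>\<Lambda> u + a\<close>; positivity of
  \<open>\<Lambda> u\<close> leaves room for \<open>r\<close> above \<open>a\<close>. Directedness
  puts \<open>v\<close> below \<open>z + r\<close> with \<open>\<Lambda> z\<close> near 0, and
  cancelling \<open>a\<close> puts \<open>u\<close> below \<open>z + (r - a)\<close>, so that
  \<open>\<Lambda> u\<close> is at most \<open>r - a\<close>.\<close>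

lemma filter_add_const:
  assumes F: "is_filter U (rho X) \<Lambda>" and "u \<in> U" "v \<in> U" "a < \<infinity>"
    and v: "\<And>x. x \<in> X \<Longrightarrow> u x + a \<le> v x" and pos: "0 < \<Lambda> u"
  shows "\<Lambda> u + a \<le> \<Lambda> v"
proof (rule ccontr)
  assume "\<not> ?thesis"
  moreover have "a < \<Lambda> u + a"
    using pos assms(4) ennreal_add_left_cancel_less[of a 0 "\<Lambda> u"] by (simp add: add.commute)
  ultimately have "max (\<Lambda> v) a < \<Lambda> u + a" by simp
  then obtain r where r: "max (\<Lambda> v) a < r" "r < \<Lambda> u + a" using dense by blast
  have "\<Lambda> u \<le> r - a"
  proof (rule ennreal_le_epsilon)
    fix e :: real assume "0 < e"
    then have "0 < ennreal e" "\<Lambda> v < r" using r(1) by simp_all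
    then obtain z where z: "z \<in> U" "\<Lambda> z \<le> ennreal e" "rho X z v \<le> r"
      using filter_directed[of U X \<Lambda> "ennreal e" v v r, OF F _ assms(3,3)] by metis
    have "u x \<le> z x + (r - a)" if "x \<in> X" for x
    proof -
      have "a + u x \<le> z x + (a + (r - a))"
        using v[OF that] z(3) that r(1) unfolding rho_le_iff
        by (metis add.commute add_diff_inverse_ennreal less_imp_le max_less_iff_conj order_trans)
      then have "a + u x \<le> a + (z x + (r - a))" by (simp only: ac_simps)
      then show ?thesis using assms(4) by (auto simp: ennreal_add_left_cancel_le)
    qed
    then have "\<Lambda> u \<le> \<Lambda> z + (r - a)" using filter_mono[OF F assms(2) z(1)] by blast
    also have "\<dots> \<le> (r - a) + ennreal e" using z(2) by (simp add: add.commute add_left_mono)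
    finally show "\<Lambda> u \<le> (r - a) + ennreal e" .
  qed
  then have "a + \<Lambda> u \<le> a + (r - a)" by (rule add_left_mono)
  also have "\<dots> = r" using r(1) by (simp add: less_imp_le)
  finally show False using r(2) by (simp add: add.commute)
qed

text \<open>
  A down-directed family is a forward Cauchy net for \<open>\<rho>\<close>, and its pointwise infimum is the colimit
  of the ideal of that net.
\<close>

lemma open_filter_INF_le:
  assumes op: "open_filter U (rho X) \<Lambda>" and C: "C \<subseteq> U" "C \<noteq> {}"
    and dir: "\<And>u v. u \<in> C \<Longrightarrow> v \<in> C \<Longrightarrow> \<exists>w\<in>C. (\<forall>x\<in>X. w x \<le> u x) \<and> (\<forall>x\<in>X. w x \<le> v x)"
    and a: "a \<in> U" "\<And>x. x \<in> X \<Longrightarrow> a x = (INF u\<in>C. u x)"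
  shows "(INF u\<in>C. \<Lambda> u) \<le> \<Lambda> a"
proof -
  \<comment> \<open>The order is reversed: further along the net means smaller functions.\<close>
  define le :: "('a \<Rightarrow> ennreal) \<Rightarrow> ('a \<Rightarrow> ennreal) \<Rightarrow> bool"
    where "le = (\<lambda>u v. \<forall>x\<in>X. v x \<le> u x)"
  define \<phi> where "\<phi> = net_weight U (rho X) C le (\<lambda>u. u)"
  have F: "is_filter U (rho X) \<Lambda>" using op by (simp add: open_filter_def)
  have dirC: "directed_set C le"
    using C(2) dir unfolding directed_set_def le_def by (auto intro: order_trans)
  have rho0: "rho X u v = 0" if "le u v" for u v
    using that by (intro rho_eq_0) (simp add: le_def)
  have "forward_cauchy U (rho X) C le (\<lambda>u. u)"
    unfolding forward_cauchy_def
  proof (intro conjI dirC)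
    obtain u where u: "u \<in> C" using C(2) by blast
    have "(INF i\<in>C. SUP j\<in>{j\<in>C. le i j}. SUP k\<in>{k\<in>C. le j k}. rho X j k)
        \<le> (SUP j\<in>{j\<in>C. le u j}. SUP k\<in>{k\<in>C. le j k}. rho X j k)"
      by (rule INF_lower[OF u])
    also have "\<dots> \<le> 0" by (intro SUP_least) (simp add: rho0)
    finally show "(INF i\<in>C. SUP j\<in>{j\<in>C. le i j}. SUP k\<in>{k\<in>C. le j k}. rho X j k) = 0" by simp
  qed (use C in auto)
  then have ideal: "is_ideal U (rho X) \<phi>"
    unfolding \<phi>_def by (rule net_weight_ideal[OF is_metric_rho])
  have \<phi>: "\<phi> z = (INF u\<in>C. rho X z u)" if z: "z \<in> U" for z
  proof -
    \<comment> \<open>Distances from \<open>z\<close> decrease along the net, so each tail supremum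
      is attained at its first index.\<close>
    have "(SUP j\<in>{j\<in>C. le i j}. rho X z j) = rho X z i" if i: "i \<in> C" for i
    proof (rule antisym)
      show "(SUP j\<in>{j\<in>C. le i j}. rho X z j) \<le> rho X z i"
        using rho_triangle[of X z _ i] rho0[of i] by (intro SUP_least) (metis add_0_right mem_Collect_eq)
      show "rho X z i \<le> (SUP j\<in>{j\<in>C. le i j}. rho X z j)"
        using i by (intro SUP_upper) (simp add: le_def)
    qed
    then show ?thesis using z by (simp add: \<phi>_def net_weight_def)
  qed
  have \<phi>0: "\<phi> u = 0" if "u \<in> C" for u
  proof -
    have "\<phi> u \<le> rho X u u" unfolding \<phi>[OF subsetD[OF C(1) that]] by (rule INF_lower[OF that])
    then show ?thesis by simp
  qed
  have "is_colimit U (rho X) \<phi> a"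
    unfolding is_colimit_def
  proof (intro conjI ballI a(1) antisym)
    fix y assume y: "y \<in> U"
    let ?R = "rho U \<phi> (\<lambda>z. rho X z y)"
    \<comment> \<open>Testing at members of \<open>C\<close>, where \<open>\<phi>\<close> vanishes,
      already gives one inequality.\<close>
    have "rho X u y \<le> ?R" if "u \<in> C" for u
      using le_add_rho[OF subsetD[OF C(1) that], of "\<lambda>z. rho X z y" \<phi>] \<phi>0[OF that] by simp
    then have "y x \<le> u x + ?R" if "x \<in> X" "u \<in> C" for x u
      using that by (simp add: rho_le_iff)
    then show "rho X a y \<le> ?R"
      by (simp add: rho_le_iff a(2) le_INF_add_ennreal)
    show "?R \<le> rho X a y"
      unfolding rho_le_iff[of U]
    proof
      fix z assume z: "z \<in> U"
      show "rho X z y \<le> \<phi> z + rho X a y"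
        unfolding \<phi>[OF z]
      proof (rule le_INF_add_ennreal)
        fix u assume u: "u \<in> C"
        have "rho X u a = 0" using u a(2) by (intro rho_eq_0) (auto intro: INF_lower)
        then have "rho X u y \<le> rho X a y" using rho_triangle[of X u y a] by simp
        then show "rho X z y \<le> rho X z u + rho X a y"
          using rho_triangle[of X z y u] by (meson add_left_mono order_trans)
      qed
    qed
  qed
  then have "is_colimit UNIV dL (\<lambda>y\<in>UNIV. INF z\<in>U. \<phi> z + dL y (\<Lambda> z)) (\<Lambda> a)"
    using op ideal by (simp add: open_filter_def scott_continuous_def)
  then have col: "dL (\<Lambda> a) b = rho UNIV (\<lambda>y. INF z\<in>U. \<phi> z + dL y (\<Lambda> z)) (\<lambda>x. dL x b)" for b
    by (simp add: is_colimit_def rho_def)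
  \<comment> \<open>At this \<open>b\<close> the left side of \<open>col\<close> is
    \<open>b \<ominus> \<Lambda> a\<close>, so it suffices that the right side vanishes.\<close>
  let ?b = "INF u\<in>C. \<Lambda> u"
  have "rho UNIV (\<lambda>y. INF z\<in>U. \<phi> z + dL y (\<Lambda> z)) (\<lambda>x. dL x ?b) = 0"
  proof (intro rho_eq_0 INF_greatest)
    fix y z assume z: "z \<in> U"
    have "?b \<le> \<phi> z + \<Lambda> z"
      unfolding \<phi>[OF z]
    proof (rule le_INF_add_ennreal)
      fix u assume u: "u \<in> C"
      have "?b \<le> \<Lambda> u" by (rule INF_lower[OF u])
      also have "\<dots> \<le> rho X z u + \<Lambda> z"
        using filter_rho[OF F z, of u] u C(1) by (auto simp: add.commute)
      finally show "?b \<le> rho X z u + \<Lambda> z" .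
    qed
    also have "\<dots> \<le> \<phi> z + (y + (\<Lambda> z \<ominus> y))"
      by (intro add_left_mono) (simp flip: ominus_le_iff)
    finally show "dL y ?b \<le> \<phi> z + dL y (\<Lambda> z)"
      by (simp add: dL_def ominus_le_iff ac_simps)
  qed
  then have "?b \<ominus> \<Lambda> a \<le> 0" by (simp add: col[symmetric] flip: dL_def)
  then show ?thesis unfolding ominus_le_iff by simp
qed

section \<open>Lower and upper regular functions\<close>

locale approach =
  fixes X :: "'a set" and \<delta> :: "'a \<Rightarrow> 'a set \<Rightarrow> ennreal"
  assumes approach: "approach_space X \<delta>"
begin

abbreviation "LX \<equiv> lower_regular X \<delta>"
abbreviation "UX \<equiv> upper_regular X \<delta>"

text \<open>For empty \<open>A\<close> both distances are infinite, so continuity is a condition on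
  nonempty \<open>A\<close> only.\<close>

lemma lower_regular_iff:
  "\<phi> \<in> LX \<longleftrightarrow> \<phi> \<in> X \<rightarrow>\<^sub>E UNIV \<and>
    (\<forall>x\<in>X. \<forall>A. A \<subseteq> X \<longrightarrow> A \<noteq> {} \<longrightarrow> \<phi> x \<le> (SUP a\<in>A. \<phi> a) + \<delta> x A)"
proof -
  have "\<delta> x {} = \<infinity>" if "x \<in> X" for x
    using approach that by (simp add: approach_space_def)
  then show ?thesis
    by (simp add: lower_regular_def approach_continuous_def delta_P_def ominus_le_iff) blast
qed

lemma lower_regularI:
  assumes "\<And>x A. x \<in> X \<Longrightarrow> A \<subseteq> X \<Longrightarrow> A \<noteq> {} \<Longrightarrow> f x \<le> (SUP a\<in>A. f a) + \<delta> x A"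
  shows "(\<lambda>x\<in>X. f x) \<in> LX"
proof -
  have "(SUP a\<in>A. (\<lambda>x\<in>X. f x) a) = (SUP a\<in>A. f a)" if "A \<subseteq> X" for A
    using that by (intro SUP_cong) auto
  then show ?thesis using assms by (simp add: lower_regular_iff)
qed

lemma lower_regularD:
  "\<phi> \<in> LX \<Longrightarrow> x \<in> X \<Longrightarrow> A \<subseteq> X \<Longrightarrow> A \<noteq> {} \<Longrightarrow> \<phi> x \<le> (SUP a\<in>A. \<phi> a) + \<delta> x A"
  by (simp add: lower_regular_iff)

lemma lower_regular_extensional: "\<phi> \<in> LX \<Longrightarrow> \<phi> \<in> extensional X"
  by (auto simp: lower_regular_def PiE_def)

lemma lower_regular_eqI:
  "\<phi> \<in> LX \<Longrightarrow> \<psi> \<in> LX \<Longrightarrow> (\<And>x. x \<in> X \<Longrightarrow> \<phi> x = \<psi> x) \<Longrightarrow> \<phi> = \<psi>"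
  by (meson extensionalityI lower_regular_extensional)

lemma lower_regular_const: "(\<lambda>x\<in>X. c) \<in> LX"
  by (rule lower_regularI) simp

lemma lower_regular_delta:
  assumes "y \<in> X"
  shows "(\<lambda>x\<in>X. \<delta> x {y}) \<in> LX"
  using approach assms by (intro lower_regularI) (simp add: approach_space_def)

lemma lower_regular_SUP:
  assumes "\<And>i. i \<in> I \<Longrightarrow> f i \<in> LX"
  shows "(\<lambda>x\<in>X. SUP i\<in>I. f i x) \<in> LX"
proof (intro lower_regularI SUP_least)
  fix x A i assume A: "x \<in> X" "A \<subseteq> X" "A \<noteq> {}" and i: "i \<in> I"
  have "(SUP a\<in>A. f i a) \<le> (SUP a\<in>A. SUP i\<in>I. f i a)"
    using i by (intro SUP_mono) (auto intro: SUP_upper)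
  then show "f i x \<le> (SUP a\<in>A. SUP i\<in>I. f i a) + \<delta> x A"
    using lower_regularD[OF assms[OF i] A] by (meson add_right_mono order_trans)
qed

lemma lower_regular_max:
  assumes "\<phi> \<in> LX" "\<psi> \<in> LX"
  shows "(\<lambda>x\<in>X. max (\<phi> x) (\<psi> x)) \<in> LX"
  using lower_regular_SUP[of "{\<phi>, \<psi>}" "\<lambda>f. f"] assms by (auto simp: sup_max)

lemma lower_regular_add:
  assumes "\<phi> \<in> LX"
  shows "(\<lambda>x\<in>X. \<phi> x + c) \<in> LX"
proof (rule lower_regularI)
  fix x A assume A: "x \<in> X" "A \<subseteq> X" "A \<noteq> {}"
  have "\<phi> x + c \<le> (SUP a\<in>A. \<phi> a) + \<delta> x A + c"
    by (intro add_right_mono lower_regularD assms A)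
  also have "\<dots> = (SUP a\<in>A. \<phi> a + c) + \<delta> x A"
    using ennreal_SUP_add_left[OF A(3), of \<phi> c] by (simp only: ac_simps)
  finally show "\<phi> x + c \<le> (SUP a\<in>A. \<phi> a + c) + \<delta> x A" .
qed

lemma lower_regular_ominus:
  assumes "\<phi> \<in> LX"
  shows "(\<lambda>x\<in>X. \<phi> x \<ominus> c) \<in> LX"
proof (rule lower_regularI)
  fix x A assume A: "x \<in> X" "A \<subseteq> X" "A \<noteq> {}"
  have "\<phi> a \<le> c + (SUP a\<in>A. \<phi> a \<ominus> c)" if "a \<in> A" for a
    using that by (subst ominus_le_iff[symmetric]) (rule SUP_upper)
  then have "(SUP a\<in>A. \<phi> a) \<le> c + (SUP a\<in>A. \<phi> a \<ominus> c)" by (rule SUP_least)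
  then have "\<phi> x \<le> c + (SUP a\<in>A. \<phi> a \<ominus> c) + \<delta> x A"
    using lower_regularD[OF assms A] by (meson add_right_mono order_trans)
  then show "\<phi> x \<ominus> c \<le> (SUP a\<in>A. \<phi> a \<ominus> c) + \<delta> x A"
    by (simp add: ominus_le_iff add.assoc)
qed

text \<open>A graded complementation: lower regular functions act as closed sets, and their duals at
  finite \<open>s\<close> act as open sets.\<close>

definition dual :: "ennreal \<Rightarrow> ('a \<Rightarrow> ennreal) \<Rightarrow> 'a \<Rightarrow> ennreal"
  where "dual s \<phi> = (\<lambda>x\<in>X. s \<ominus> \<phi> x)"

text \<open>The issue is regularity of \<open>r \<ominus> (s \<ominus> \<phi>)\<close>. For finite
  \<open>s\<close> and nonempty \<open>A\<close>, subtraction from \<open>s\<close> turns the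
  supremum of \<open>\<phi>\<close> over \<open>A\<close> into the infimum of the dual, and
  \<open>\<phi> x\<close> exceeds that supremum by at most \<open>\<delta> x A\<close>.\<close>

lemma dual_upper_regular:
  assumes "\<phi> \<in> LX" "s < \<infinity>"
  shows "dual s \<phi> \<in> UX"
proof -
  have "(\<lambda>x\<in>X. r \<ominus> dual s \<phi> x) \<in> LX" for r
  proof -
    have "(\<lambda>x\<in>X. r \<ominus> (s \<ominus> \<phi> x)) \<in> LX"
    proof (rule lower_regularI)
      fix x A assume A: "x \<in> X" "A \<subseteq> X" "A \<noteq> {}"
      let ?K = "SUP a\<in>A. r \<ominus> (s \<ominus> \<phi> a)"
      have "r \<le> (s \<ominus> \<phi> a) + ?K" if "a \<in> A" for a
        using that by (subst ominus_le_iff[symmetric]) (rule SUP_upper)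
      then have "r \<le> (INF a\<in>A. s \<ominus> \<phi> a) + ?K" by (rule le_INF_add_ennreal)
      also have "(INF a\<in>A. s \<ominus> \<phi> a) = s \<ominus> (SUP a\<in>A. \<phi> a)"
        using A(3) assms(2) by (simp add: ominus_eq_minus ennreal_SUP_const_minus)
      also have "s \<ominus> (SUP a\<in>A. \<phi> a) \<le> (s \<ominus> \<phi> x) + \<delta> x A"
      proof -
        have "s \<le> \<phi> x + (s \<ominus> \<phi> x)" by (simp flip: ominus_le_iff)
        also have "\<dots> \<le> (SUP a\<in>A. \<phi> a) + \<delta> x A + (s \<ominus> \<phi> x)"
          by (intro add_right_mono lower_regularD assms A)
        finally show ?thesis by (simp add: ominus_le_iff ac_simps)
      qed
      finally show "r \<ominus> (s \<ominus> \<phi> x) \<le> ?K + \<delta> x A"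
        by (simp add: ominus_le_iff ac_simps add_right_mono)
    qed
    then show ?thesis by (simp add: dual_def cong: restrict_cong)
  qed
  moreover have "(SUP x\<in>X. dual s \<phi> x) \<le> s"
    by (rule SUP_least) (simp add: dual_def ominus_le_iff)
  ultimately show ?thesis
    using assms(2) by (auto simp: upper_regular_def dual_def intro: le_less_trans)
qed

lemma const_fun_upper_regular: "const_fun X r \<in> UX"
proof (cases "r = \<infinity>")
  case False
  have "const_fun X r = dual r (\<lambda>x\<in>X. 0)"
    by (auto simp: const_fun_def dual_def ominus_def fun_eq_iff)
  then show ?thesis
    using dual_upper_regular[OF lower_regular_const, of r 0] False by (simp add: less_top)
qed (simp add: upper_regular_def const_fun_def)

text \<open>With \<open>M\<close> the supremum of \<open>u\<close>, the difference
  \<open>M \<ominus> u\<close> is nowhere truncated; later estimates can then cancel in exact finite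
  sums.\<close>

lemma upper_regular_bounded:
  assumes "u \<in> UX" "u \<noteq> const_fun X \<infinity>"
  obtains M \<phi> where "M < \<infinity>" "\<phi> \<in> LX" "\<And>x. x \<in> X \<Longrightarrow> u x + \<phi> x = M"
proof -
  define M where "M = (SUP x\<in>X. u x)"
  have M: "M < \<infinity>" "(\<lambda>x\<in>X. M \<ominus> u x) \<in> LX"
    using assms by (auto simp: upper_regular_def M_def)
  moreover have "u x + (\<lambda>x\<in>X. M \<ominus> u x) x = M" if "x \<in> X" for x
    using that M(1) by (simp add: ominus_eq_minus M_def SUP_upper)
  ultimately show thesis by (rule that)
qed

text \<open>Lower regularity of the complement \<open>\<phi>\<close>, applied to a singleton, turns
  into this bound once the finite value \<open>\<phi> y\<close> is cancelled.\<close>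

lemma upper_regular_delta:
  assumes "u \<in> UX" "x \<in> X" "y \<in> X"
  shows "u y \<le> u x + \<delta> x {y}"
proof (cases "u = const_fun X \<infinity>")
  case True
  then show ?thesis using assms by (simp add: const_fun_def)
next
  case False
  then obtain M \<phi> where M: "M < \<infinity>" "\<phi> \<in> LX" "\<And>x. x \<in> X \<Longrightarrow> u x + \<phi> x = M"
    using upper_regular_bounded[OF assms(1)] by metis
  have "\<phi> x \<le> \<phi> y + \<delta> x {y}" using lower_regularD[OF M(2), of x "{y}"] assms by simp
  then have "M \<le> u x + (\<phi> y + \<delta> x {y})" using M(3)[OF assms(2)] by (metis add_left_mono)
  then have "\<phi> y + u y \<le> \<phi> y + (u x + \<delta> x {y})" using M(3)[OF assms(3)] by (simp add: ac_simps)
  moreover have "\<phi> y \<noteq> \<infinity>" using M(1) M(3)[OF assms(3)] by auto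
  ultimately show ?thesis by (simp add: ennreal_add_left_cancel_le)
qed

section \<open>Recovering a saturated function\<close>

text \<open>
  A saturated \<open>\<eta>\<close> is the supremum of the upper regular functions \<open>r \<ominus> \<delta>(-, {y})\<close> with \<open>r < \<eta>(y)\<close>.
\<close>

lemma rho_rho_from:
  assumes "saturated_fun X \<delta> \<eta>"
  shows "rho X \<theta> \<eta> = rho UX (rho_from X \<delta> \<eta>) (rho_from X \<delta> \<theta>)"
proof (rule antisym)
  let ?R = "rho UX (rho_from X \<delta> \<eta>) (rho_from X \<delta> \<theta>)"
  show "?R \<le> rho X \<theta> \<eta>"
    using rho_triangle[of X \<theta> _ \<eta>] by (simp add: rho_le_iff[of UX] rho_from_def add.commute)
  show "rho X \<theta> \<eta> \<le> ?R"
    unfolding rho_le_iff[of X]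
  proof
    fix y assume y: "y \<in> X"
    show "\<eta> y \<le> \<theta> y + ?R"
    proof (rule dense_le)
      fix r assume r: "r < \<eta> y"
      \<comment> \<open>This function has value \<open>r\<close> at \<open>y\<close>, and saturation
        keeps it below \<open>\<eta>\<close>.\<close>
      define u where "u = dual r (\<lambda>x\<in>X. \<delta> x {y})"
      have "r < \<infinity>" using r less_le_trans[OF r top_greatest] by simp
      then have u: "u \<in> UX"
        unfolding u_def by (intro dual_upper_regular lower_regular_delta y)
      have "u x \<le> \<eta> x" if "x \<in> X" for x
      proof -
        have "r \<le> \<delta> x {y} + \<eta> x"
          using assms that y r by (auto simp: saturated_fun_def intro: order_trans[OF less_imp_le])
        then show ?thesis using that by (simp add: u_def dual_def ominus_le_iff)
      qed
      then have "rho X \<eta> u = 0" by (rule rho_eq_0)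
      then have le: "rho X \<theta> u \<le> ?R"
        using le_add_rho[OF u, of "rho_from X \<delta> \<theta>" "rho_from X \<delta> \<eta>"] u by (simp add: rho_from_def)
      have "\<delta> y {y} = 0" using approach y by (simp add: approach_space_def)
      then have "u y = r" using y by (auto simp: u_def dual_def ominus_def)
      then have "r \<le> \<theta> y + rho X \<theta> u" using le_add_rho[OF y, of u \<theta>] by simp
      then show "r \<le> \<theta> y + ?R" using le by (meson add_left_mono order_trans)
    qed
  qed
qed

text \<open>By \<open>rho_rho_from\<close> the two functions have distance 0 in both
  directions.\<close>

lemma saturated_eqI:
  assumes "saturated_fun X \<delta> \<theta>" "saturated_fun X \<delta> \<eta>"
    and "\<And>u. u \<in> UX \<Longrightarrow> rho X \<theta> u = rho X \<eta> u"
  shows "\<theta> = \<eta>"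
proof -
  have "rho X \<theta> \<eta> \<le> 0" "rho X \<eta> \<theta> \<le> 0"
    unfolding rho_rho_from[OF assms(1)] rho_rho_from[OF assms(2)] rho_le_iff[of UX]
    using assms(3) by (simp_all add: rho_from_def)
  then have "\<theta> x = \<eta> x" if "x \<in> X" for x
    unfolding rho_le_iff using that by (simp add: antisym)
  then show ?thesis
    using assms(1,2) by (auto simp: saturated_fun_def intro: PiE_ext)
qed

end

section \<open>Points from maximal lower regular functions\<close>

locale approach_open_filter = approach +
  fixes \<Lambda> :: "('a \<Rightarrow> ennreal) \<Rightarrow> ennreal"
  assumes open_filter: "open_filter UX (rho X) \<Lambda>"
begin

lemma is_filter: "is_filter UX (rho X) \<Lambda>"
  using open_filter by (simp add: open_filter_def)

lemma filter_fun_mono: "u \<in> UX \<Longrightarrow> v \<in> UX \<Longrightarrow> (\<And>x. x \<in> X \<Longrightarrow> u x \<le> v x) \<Longrightarrow> \<Lambda> u \<le> \<Lambda> v"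
  using filter_mono[OF is_filter, of u v 0] by simp

text \<open>A filter takes arbitrarily small values, and the zero function lies below every
  argument.\<close>

lemma filter_fun_zero:
  assumes "u \<in> UX" "\<And>x. x \<in> X \<Longrightarrow> u x = 0"
  shows "\<Lambda> u = 0"
proof -
  have "\<Lambda> u \<le> e" if e: "0 < e" for e
  proof -
    obtain w where "w \<in> UX" "\<Lambda> w \<le> e"
      using ideal_small[of UX "op_metric (rho X)" \<Lambda> e] is_filter[unfolded is_filter_def] e
      by metis
    then show ?thesis using filter_fun_mono[OF assms(1), of w] assms(2) by simp
  qed
  then have "\<Lambda> u \<le> 0" by (rule dense_ge)
  then show ?thesis by simp
qed

text \<open>
  If \<open>\<Lambda> = \<rho>\<^sub>X(\<nu>, -)\<close>, then \<open>\<delta>(-, {x})\<close> has level \<open>c\<close> exactly when \<open>\<nu>(x) \<le> c\<close>.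
\<close>

definition level :: "ennreal \<Rightarrow> ('a \<Rightarrow> ennreal) \<Rightarrow> bool"
  where "level c \<phi> \<longleftrightarrow> \<phi> \<in> LX \<and> (\<forall>s<\<infinity>. s \<le> c + \<Lambda> (dual s \<phi>))"

text \<open>Here openness enters: \<open>dual s\<close> turns a chain into a down-directed family
  whose infimum is the dual of the supremum, so \<open>open_filter_INF_le\<close> applies.\<close>

lemma level_SUP:
  assumes C: "\<And>\<phi>. \<phi> \<in> C \<Longrightarrow> level c \<phi>" "C \<noteq> {}"
    and chain: "\<And>\<phi> \<psi>. \<phi> \<in> C \<Longrightarrow> \<psi> \<in> C \<Longrightarrow> (\<forall>x\<in>X. \<phi> x \<le> \<psi> x) \<or> (\<forall>x\<in>X. \<psi> x \<le> \<phi> x)"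
  shows "level c (\<lambda>x\<in>X. SUP \<phi>\<in>C. \<phi> x)"
proof -
  let ?\<sigma> = "\<lambda>x\<in>X. SUP \<phi>\<in>C. \<phi> x"
  have L: "\<phi> \<in> LX" if "\<phi> \<in> C" for \<phi> using C(1) that by (simp add: level_def)
  have \<sigma>: "?\<sigma> \<in> LX" using lower_regular_SUP[of C "\<lambda>\<phi>. \<phi>"] L by simp
  have "s \<le> c + \<Lambda> (dual s ?\<sigma>)" if s: "s < \<infinity>" for s
  proof -
    have anti: "dual s \<psi> x \<le> dual s \<phi> x" if "x \<in> X" "\<phi> x \<le> \<psi> x" for \<phi> \<psi> x
    proof -
      have "s \<le> \<phi> x + (s \<ominus> \<phi> x)" by (simp flip: ominus_le_iff)
      also have "\<dots> \<le> \<psi> x + (s \<ominus> \<phi> x)" by (rule add_right_mono[OF that(2)])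
      finally show ?thesis using that(1) by (simp add: dual_def ominus_le_iff)
    qed
    have "(INF u\<in>dual s ` C. \<Lambda> u) \<le> \<Lambda> (dual s ?\<sigma>)"
    proof (rule open_filter_INF_le[OF open_filter])
      show "dual s ` C \<subseteq> UX" using dual_upper_regular[OF L s] by blast
      show "dual s ` C \<noteq> {}" using C(2) by simp
      show "\<exists>w\<in>dual s ` C. (\<forall>x\<in>X. w x \<le> u x) \<and> (\<forall>x\<in>X. w x \<le> v x)"
        if uv: "u \<in> dual s ` C" "v \<in> dual s ` C" for u v
      proof -
        obtain \<phi> \<psi> where *: "\<phi> \<in> C" "\<psi> \<in> C" "u = dual s \<phi>" "v = dual s \<psi>" using uv by blast
        show ?thesis using chain[OF *(1,2)]
        proof
          assume "\<forall>x\<in>X. \<phi> x \<le> \<psi> x"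
          then show ?thesis using * anti[of _ \<phi> \<psi>] by blast
        next
          assume "\<forall>x\<in>X. \<psi> x \<le> \<phi> x"
          then show ?thesis using * anti[of _ \<psi> \<phi>] by blast
        qed
      qed
      show "dual s ?\<sigma> \<in> UX" by (rule dual_upper_regular[OF \<sigma> s])
      show "dual s ?\<sigma> x = (INF u\<in>dual s ` C. u x)" if "x \<in> X" for x
        using that s C(2)
        by (simp add: dual_def ominus_eq_minus ennreal_SUP_const_minus image_comp)
    qed
    moreover have "s \<le> (INF \<phi>\<in>C. \<Lambda> (dual s \<phi>)) + c"
      by (rule le_INF_add_ennreal) (use C(1) s in \<open>simp add: level_def add.commute\<close>)
    ultimately show ?thesis
      by (simp add: image_comp add.commute) (meson add_left_mono order_trans)
  qed
  then show ?thesis using \<sigma> by (simp add: level_def)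
qed

lemma level_maximal:
  assumes "level c \<phi>0"
  obtains \<phi> where "level c \<phi>" "\<And>x. x \<in> X \<Longrightarrow> \<phi>0 x \<le> \<phi> x"
    "\<And>\<psi>. level c \<psi> \<Longrightarrow> (\<And>x. x \<in> X \<Longrightarrow> \<phi> x \<le> \<psi> x) \<Longrightarrow> \<psi> = \<phi>"
proof -
  define P where "P = (\<lambda>\<phi> \<psi> :: 'a \<Rightarrow> ennreal. \<forall>x\<in>X. \<phi> x \<le> \<psi> x)"
  define A where "A = {\<phi>. level c \<phi> \<and> P \<phi>0 \<phi>}"
  have trans: "P \<phi> \<chi>" if "P \<phi> \<psi>" "P \<psi> \<chi>" for \<phi> \<psi> \<chi>
    using that unfolding P_def by (meson order_trans)
  have "\<exists>\<phi>\<in>A. \<forall>\<psi>\<in>A. P \<phi> \<psi> \<longrightarrow> \<psi> = \<phi>"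
  proof (rule predicate_Zorn)
    show "partial_order_on A (relation_of P A)"
    proof (rule partial_order_on_relation_ofI)
      show "P \<phi> \<phi>" for \<phi> by (simp add: P_def)
      show "P \<phi> \<chi>" if "P \<phi> \<psi>" "P \<psi> \<chi>" for \<phi> \<psi> \<chi> by (rule trans[OF that])
      show "\<phi> = \<psi>" if "\<phi> \<in> A" "\<psi> \<in> A" "P \<phi> \<psi>" "P \<psi> \<phi>" for \<phi> \<psi>
        by (rule lower_regular_eqI) (use that in \<open>auto simp: A_def P_def level_def intro: antisym\<close>)
    qed
    fix C assume "C \<in> Chains (relation_of P A)"
    then have CA: "C \<subseteq> A" and chain: "\<And>\<phi> \<psi>. \<phi> \<in> C \<Longrightarrow> \<psi> \<in> C \<Longrightarrow> P \<phi> \<psi> \<or> P \<psi> \<phi>"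
      by (auto simp: Chains_def relation_of_def)
    show "\<exists>\<psi>\<in>A. \<forall>\<phi>\<in>C. P \<phi> \<psi>"
    \<comment> \<open>The empty supremum is 0, which need not lie above \<open>\<phi>0\<close>; the
      empty chain is bounded by \<open>\<phi>0\<close> itself.\<close>
    proof (cases "C = {}")
      case True
      then show ?thesis using assms by (auto simp: A_def P_def)
    next
      case False
      let ?\<sigma> = "\<lambda>x\<in>X. SUP \<phi>\<in>C. \<phi> x"
      have "level c ?\<sigma>"
        using CA chain False by (intro level_SUP) (auto simp: A_def P_def)
      moreover have up: "P \<phi> ?\<sigma>" if "\<phi> \<in> C" for \<phi>
        using that by (auto simp: P_def intro: SUP_upper2)
      moreover have "P \<phi>0 ?\<sigma>"
        using False CA up trans unfolding A_def by blast
      ultimately show ?thesis by (auto simp: A_def)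
    qed
  qed
  then obtain \<phi> where \<phi>: "\<phi> \<in> A" "\<And>\<psi>. \<psi> \<in> A \<Longrightarrow> P \<phi> \<psi> \<Longrightarrow> \<psi> = \<phi>" by blast
  show thesis
  proof (rule that)
    show "\<phi>0 x \<le> \<phi> x" if "x \<in> X" for x using \<phi>(1) that by (auto simp: A_def P_def)
    show "level c \<phi>" using \<phi>(1) by (simp add: A_def)
    show "\<psi> = \<phi>" if "level c \<psi>" "\<And>x. x \<in> X \<Longrightarrow> \<phi> x \<le> \<psi> x" for \<psi>
      using \<phi> that trans[of \<phi>0 \<phi> \<psi>] by (auto simp: A_def P_def)
  qed
qed

text \<open>Raising \<open>s\<close> to \<open>s'\<close> raises the dual by at most
  \<open>s' - s\<close>, so a failure of the level condition persists. Two failures can thus be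
  compared at a common finite value.\<close>

lemma not_level_mono:
  assumes "\<psi> \<in> LX" "c + \<Lambda> (dual s \<psi>) < s" "s \<le> s'" "s' < \<infinity>"
  shows "c + \<Lambda> (dual s' \<psi>) < s'"
proof -
  have s: "s < \<infinity>" using assms(3,4) by (rule le_less_trans)
  have "\<Lambda> (dual s' \<psi>) \<le> \<Lambda> (dual s \<psi>) + (s' - s)"
  proof (rule filter_mono[OF is_filter])
    fix x assume "x \<in> X"
    have "s' = s + (s' - s)" by (rule add_diff_inverse_ennreal[OF assms(3), symmetric])
    also have "\<dots> \<le> \<psi> x + (s \<ominus> \<psi> x) + (s' - s)"
      by (intro add_right_mono) (simp flip: ominus_le_iff)
    finally show "dual s' \<psi> x \<le> dual s \<psi> x + (s' - s)"
      using \<open>x \<in> X\<close> by (simp add: dual_def ominus_le_iff add.assoc)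
  qed (use assms s dual_upper_regular in auto)
  then have "c + \<Lambda> (dual s' \<psi>) \<le> (s' - s) + (c + \<Lambda> (dual s \<psi>))"
    by (metis (no_types, lifting) add.assoc add.commute add_left_mono)
  also have "\<dots> < (s' - s) + s"
    using assms(2,4) by (simp add: ennreal_add_left_cancel_less)
  also have "\<dots> = s'" using assms(3) by (simp add: add.commute)
  finally show ?thesis .
qed

text \<open>If neither \<open>\<phi>1\<close> nor \<open>\<phi>2\<close> is below
  \<open>\<phi>\<close>, then by maximality their maxima with \<open>\<phi>\<close> fail the level
  condition. At each point one of these maxima equals \<open>\<phi>\<close>, so
  \<open>filter_max\<close> makes \<open>\<phi>\<close> fail too.\<close>

lemma level_maximal_irreducible:
  assumes \<phi>: "level c \<phi>"
    and max: "\<And>\<psi>. level c \<psi> \<Longrightarrow> (\<And>x. x \<in> X \<Longrightarrow> \<phi> x \<le> \<psi> x) \<Longrightarrow> \<psi> = \<phi>"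
  shows "irreducible_fun X \<delta> \<phi>"
proof -
  have L: "\<phi> \<in> LX" using \<phi> by (simp add: level_def)
  have "(\<forall>x\<in>X. \<phi>1 x \<le> \<phi> x) \<or> (\<forall>x\<in>X. \<phi>2 x \<le> \<phi> x)"
    if i: "\<phi>1 \<in> LX" "\<phi>2 \<in> LX" and le: "\<forall>x\<in>X. min (\<phi>1 x) (\<phi>2 x) \<le> \<phi> x" for \<phi>1 \<phi>2
  proof (rule ccontr)
    assume neg: "\<not> ?thesis"
    have fail: "\<exists>s<\<infinity>. c + \<Lambda> (dual s (\<lambda>x\<in>X. max (\<phi> x) (\<psi> x))) < s"
      if "\<psi> \<in> LX" "\<not> (\<forall>x\<in>X. \<psi> x \<le> \<phi> x)" for \<psi>
    proof (rule ccontr)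
      assume "\<not> ?thesis"
      then have "level c (\<lambda>x\<in>X. max (\<phi> x) (\<psi> x))"
        using lower_regular_max[OF L that(1)] unfolding level_def by (meson not_less)
      then have "(\<lambda>x\<in>X. max (\<phi> x) (\<psi> x)) = \<phi>" by (rule max) simp
      then show False using that(2) by (metis max.cobounded2 restrict_apply')
    qed
    define \<psi>1 where "\<psi>1 = (\<lambda>x\<in>X. max (\<phi> x) (\<phi>1 x))"
    define \<psi>2 where "\<psi>2 = (\<lambda>x\<in>X. max (\<phi> x) (\<phi>2 x))"
    obtain s1 s2 where s12: "s1 < \<infinity>" "c + \<Lambda> (dual s1 \<psi>1) < s1" "s2 < \<infinity>" "c + \<Lambda> (dual s2 \<psi>2) < s2"
      using fail[OF i(1)] fail[OF i(2)] neg unfolding \<psi>1_def \<psi>2_def by blast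
    have \<psi>L: "\<psi>1 \<in> LX" "\<psi>2 \<in> LX"
      unfolding \<psi>1_def \<psi>2_def by (intro lower_regular_max L i)+
    define s where "s = max s1 s2"
    have s: "s < \<infinity>" using s12 by (simp add: s_def)
    have lt: "c + \<Lambda> (dual s \<psi>1) < s" "c + \<Lambda> (dual s \<psi>2) < s"
      using not_level_mono[OF \<psi>L(1) s12(2) _ s] not_level_mono[OF \<psi>L(2) s12(4) _ s]
      by (simp_all add: s_def)
    have "\<Lambda> (dual s \<phi>) \<le> max (\<Lambda> (dual s \<psi>1)) (\<Lambda> (dual s \<psi>2))"
    proof (rule filter_max[OF is_filter])
      fix x assume x: "x \<in> X"
      have "\<phi> x = \<psi>1 x \<or> \<phi> x = \<psi>2 x"
        using le x by (auto simp: \<psi>1_def \<psi>2_def min_le_iff_disj max_absorb1)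
      then show "dual s \<phi> x \<le> max (dual s \<psi>1 x) (dual s \<psi>2 x)"
        using x by (auto simp: dual_def)
    qed (use dual_upper_regular s L \<psi>L in auto)
    then have "c + \<Lambda> (dual s \<phi>) < s"
      using lt by (auto simp: max_def split: if_splits intro: le_less_trans[OF add_left_mono])
    then show False using \<phi> s by (auto simp: level_def not_less[symmetric])
  qed
  then show ?thesis using L by (simp add: irreducible_fun_def)
qed

text \<open>For \<open>s\<close> strictly between \<open>c\<close> and the infimum, the dual at
  \<open>s\<close> vanishes, so the level condition would read \<open>s \<le> c\<close>.\<close>

lemma level_INF_le:
  assumes "level c \<phi>"
  shows "(INF x\<in>X. \<phi> x) \<le> c"
proof (rule ccontr)
  assume "\<not> ?thesis"
  then obtain s where s: "c < s" "s < (INF x\<in>X. \<phi> x)" by (meson dense not_le)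
  have "s < \<infinity>" using less_le_trans[OF s(2) top_greatest] by simp
  moreover have "\<phi> \<in> LX" using assms by (simp add: level_def)
  moreover have "dual s \<phi> x = 0" if "x \<in> X" for x
  proof -
    have "s \<le> \<phi> x" using s(2) INF_lower[OF that, of \<phi>] by simp
    then show ?thesis using that by (simp add: dual_def ominus_def)
  qed
  ultimately have "\<Lambda> (dual s \<phi>) = 0" by (intro filter_fun_zero dual_upper_regular)
  then show False using assms s(1) \<open>s < \<infinity>\<close> by (auto simp: level_def)
qed

text \<open>
  Subtracting its infimum makes a maximal function of level \<open>c\<close> inhabited and keeps it irreducible;
  soberness then represents it by a point.
\<close>

lemma level_point:
  assumes sober: "sober X \<delta>" and c: "c < \<infinity>" and "level c \<phi>0"
  obtains x t where "x \<in> X" "t \<le> c" "\<phi>0 x \<le> t" "level (c - t) (\<lambda>y\<in>X. \<delta> y {x})"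
proof -
  obtain \<phi> where \<phi>: "level c \<phi>" "\<And>x. x \<in> X \<Longrightarrow> \<phi>0 x \<le> \<phi> x"
    and max: "\<And>\<psi>. level c \<psi> \<Longrightarrow> (\<And>x. x \<in> X \<Longrightarrow> \<phi> x \<le> \<psi> x) \<Longrightarrow> \<psi> = \<phi>"
    using level_maximal[OF assms(3)] by metis
  have irr: "irreducible_fun X \<delta> \<phi>" using level_maximal_irreducible[OF \<phi>(1) max] .
  have L: "\<phi> \<in> LX" using \<phi>(1) by (simp add: level_def)
  define t where "t = (INF x\<in>X. \<phi> x)"
  have tc: "t \<le> c" unfolding t_def by (rule level_INF_le[OF \<phi>(1)])
  then have t: "t \<noteq> \<infinity>" using c by auto
  define \<chi> where "\<chi> = (\<lambda>x\<in>X. \<phi> x \<ominus> t)"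
  have \<chi>: "t + \<chi> x = \<phi> x" if "x \<in> X" for x
  proof -
    have "t \<le> \<phi> x" unfolding t_def by (rule INF_lower[OF that])
    then show ?thesis using that by (auto simp: \<chi>_def ominus_def)
  qed
  have \<chi>L: "\<chi> \<in> LX" unfolding \<chi>_def by (rule lower_regular_ominus[OF L])
  have "t + (INF x\<in>X. \<chi> x) \<le> (INF x\<in>X. \<phi> x)"
    by (rule INF_greatest) (use \<chi> in \<open>metis INF_lower add_left_mono\<close>)
  then have "t + (INF x\<in>X. \<chi> x) \<le> t + 0" by (simp add: t_def)
  then have "inhabited_fun X \<chi>"
    using t by (simp add: inhabited_fun_def ennreal_add_left_cancel_le del: add_0_right)
  moreover have "irreducible_fun X \<delta> \<chi>"
    unfolding irreducible_fun_def
  proof (intro conjI ballI impI \<chi>L)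
    fix \<phi>1 \<phi>2 assume i: "\<phi>1 \<in> LX" "\<phi>2 \<in> LX" and le: "\<forall>x\<in>X. min (\<phi>1 x) (\<phi>2 x) \<le> \<chi> x"
    \<comment> \<open>Adding \<open>t\<close> carries the hypothesis on \<open>\<chi>\<close> over
      to \<open>\<phi>\<close>, which is irreducible; the finite \<open>t\<close> is cancelled
      afterwards.\<close>
    have "min ((\<lambda>x\<in>X. \<phi>1 x + t) x) ((\<lambda>x\<in>X. \<phi>2 x + t) x) \<le> \<phi> x" if "x \<in> X" for x
    proof -
      have "min (\<phi>1 x) (\<phi>2 x) + t \<le> \<phi> x"
        using le that \<chi>[OF that] by (metis add.commute add_left_mono)
      then show ?thesis
        using that unfolding min_le_iff_disj by (simp add: min_def split: if_splits)
    qed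
    then have "(\<forall>x\<in>X. (\<lambda>x\<in>X. \<phi>1 x + t) x \<le> \<phi> x) \<or> (\<forall>x\<in>X. (\<lambda>x\<in>X. \<phi>2 x + t) x \<le> \<phi> x)"
      using irr lower_regular_add[OF i(1), of t] lower_regular_add[OF i(2), of t]
      unfolding irreducible_fun_def by blast
    moreover have "f x \<le> \<chi> x" if "x \<in> X" "f x + t \<le> \<phi> x" for f x
      using that t unfolding \<chi>[OF that(1), symmetric]
      by (simp add: add.commute[of _ t] ennreal_add_left_cancel_le)
    ultimately show "(\<forall>x\<in>X. \<phi>1 x \<le> \<chi> x) \<or> (\<forall>x\<in>X. \<phi>2 x \<le> \<chi> x)" by auto
  qed
  ultimately obtain x where x: "x \<in> X" "\<chi> = (\<lambda>y\<in>X. \<delta> y {x})"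
    using sober unfolding sober_def by blast
  \<comment> \<open>The infimum \<open>t\<close> of \<open>\<phi>\<close> is thus attained at
    \<open>x\<close>, which bounds \<open>\<phi>0 x\<close> by \<open>t\<close>.\<close>
  have "\<chi> x = 0" using approach x by (simp add: approach_space_def)
  then have "\<phi> x = t" using \<chi>[OF x(1)] by simp
  moreover have "level (c - t) \<chi>"
    unfolding level_def
  proof (intro conjI \<chi>L allI impI)
    fix s :: ennreal assume s: "s < \<infinity>"
    \<comment> \<open>Shifting by \<open>t\<close> turns level \<open>c\<close> of
      \<open>\<phi>\<close> at \<open>t + s\<close> into level \<open>c - t\<close> of
      \<open>\<chi>\<close> at \<open>s\<close>.\<close>
    have "dual s \<chi> = dual (t + s) \<phi>"
    proof -
      have "s \<ominus> \<chi> y = (t + s) \<ominus> \<phi> y" if "y \<in> X" for y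
      proof -
        have "s \<ominus> \<chi> y \<le> k \<longleftrightarrow> (t + s) \<ominus> \<phi> y \<le> k" for k
          using t \<chi>[OF that, symmetric]
          by (simp add: ominus_le_iff add.assoc ennreal_add_left_cancel_le)
        then show ?thesis by (meson order_refl antisym)
      qed
      then show ?thesis by (auto simp: dual_def)
    qed
    moreover have "t + s \<le> c + \<Lambda> (dual (t + s) \<phi>)"
      using \<phi>(1) s t by (simp add: level_def less_top)
    ultimately have "t + s \<le> (t + (c - t)) + \<Lambda> (dual s \<chi>)"
      by (simp only: add_diff_inverse_ennreal[OF tc])
    then have "t + s \<le> t + (c - t + \<Lambda> (dual s \<chi>))" by (simp only: add.assoc)
    then show "s \<le> c - t + \<Lambda> (dual s \<chi>)"
      using t by (simp add: ennreal_add_left_cancel_le)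
  qed
  ultimately show thesis using that[OF x(1) tc] \<phi>(2)[OF x(1)] x(2) by simp
qed

text \<open>The number \<open>k\<close> bounds the value at \<open>x\<close> of the function to be constructed.\<close>

lemma point_below:
  assumes "sober X \<delta>" and u: "u \<in> UX" "u \<noteq> const_fun X \<infinity>" "0 < \<Lambda> u"
  obtains x k where "x \<in> X" "u x < \<infinity>" "k + \<Lambda> u \<le> u x" "\<And>v. v \<in> UX \<Longrightarrow> v x \<le> k + \<Lambda> v"
proof -
  obtain M \<phi>0 where M: "M < \<infinity>" "\<phi>0 \<in> LX" "\<And>x. x \<in> X \<Longrightarrow> u x + \<phi>0 x = M"
    using upper_regular_bounded[OF u(1,2)] by metis
  have "u x \<le> M" if "x \<in> X" for x using M(3)[OF that] le_iff_add by metis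
  then have "\<Lambda> u \<le> \<Lambda> (const_fun X 0) + M"
    by (intro filter_mono[OF is_filter u(1) const_fun_upper_regular]) (simp add: const_fun_def)
  then have uM: "\<Lambda> u \<le> M"
    using filter_fun_zero[OF const_fun_upper_regular, of 0] by (simp add: const_fun_def)
  \<comment> \<open>At \<open>s = M\<close> the dual of \<open>\<phi>0\<close> agrees with
    \<open>u\<close> on \<open>X\<close>, and this \<open>c\<close> makes the level condition an
    equality there.\<close>
  define c where "c = M - \<Lambda> u"
  have c: "c + \<Lambda> u = M" "c < \<infinity>"
    using uM M(1) by (auto simp: c_def add.commute intro: le_less_trans[OF diff_le_self_ennreal])
  have "s \<le> c + \<Lambda> (dual s \<phi>0)" if s: "s < \<infinity>" for s
  proof -
    have d: "dual s \<phi>0 \<in> UX" by (rule dual_upper_regular[OF M(2) s])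
    show ?thesis
    proof (cases "s \<le> M")
      case True
      have "\<Lambda> u \<le> \<Lambda> (dual s \<phi>0) + (M - s)"
      proof (rule filter_mono[OF is_filter u(1) d])
        fix x assume x: "x \<in> X"
        have "\<phi>0 x + u x = s + (M - s)"
          using M(3)[OF x] add_diff_inverse_ennreal[OF True] by (simp only: add.commute)
        also have "\<dots> \<le> \<phi>0 x + (s \<ominus> \<phi>0 x) + (M - s)"
          by (intro add_right_mono) (simp flip: ominus_le_iff)
        finally have "\<phi>0 x + u x \<le> \<phi>0 x + (dual s \<phi>0 x + (M - s))"
          using x by (simp add: dual_def add.assoc)
        moreover have "\<phi>0 x \<noteq> \<infinity>" using M(1) M(3)[OF x] by auto
        ultimately show "u x \<le> dual s \<phi>0 x + (M - s)" by (simp add: ennreal_add_left_cancel_le)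
      qed
      then have "c + \<Lambda> u \<le> c + (\<Lambda> (dual s \<phi>0) + (M - s))" by (rule add_left_mono)
      then have "s + (M - s) \<le> c + (\<Lambda> (dual s \<phi>0) + (M - s))"
        unfolding c(1) add_diff_inverse_ennreal[OF True] .
      then have "(M - s) + s \<le> (M - s) + (c + \<Lambda> (dual s \<phi>0))"
        by (simp only: ac_simps)
      moreover have "M - s \<noteq> \<infinity>" using M(1) by (auto simp: ennreal_minus_eq_top)
      ultimately show ?thesis by (simp add: ennreal_add_left_cancel_le)
    next
      case False
      then have sM: "M + (s - M) = s" by simp
      \<comment> \<open>Beyond \<open>M\<close> the dual exceeds \<open>u\<close> by
        \<open>s - M\<close>, and \<open>\<Lambda>\<close> has to grow by as much; this uses
        \<open>0 < \<Lambda> u\<close>.\<close>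
      have "\<Lambda> u + (s - M) \<le> \<Lambda> (dual s \<phi>0)"
      proof (rule filter_add_const[OF is_filter u(1) d _ _ u(3)])
        show "s - M < \<infinity>" using s by (rule le_less_trans[OF diff_le_self_ennreal])
        fix x assume x: "x \<in> X"
        have "\<phi>0 x + (u x + (s - M)) = u x + \<phi>0 x + (s - M)" by (simp only: ac_simps)
        also have "\<dots> = s" unfolding M(3)[OF x] by (rule sM)
        finally have "\<phi>0 x + (u x + (s - M)) = s" .
        moreover have "s \<le> \<phi>0 x + (s \<ominus> \<phi>0 x)" by (simp flip: ominus_le_iff)
        moreover have "\<phi>0 x \<noteq> \<infinity>" using M(1) M(3)[OF x] by auto
        ultimately show "u x + (s - M) \<le> dual s \<phi>0 x"
          using x by (metis dual_def ennreal_add_left_cancel_le restrict_apply')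
      qed
      then have "c + (\<Lambda> u + (s - M)) \<le> c + \<Lambda> (dual s \<phi>0)" by (rule add_left_mono)
      then show ?thesis using c(1) sM by (simp flip: add.assoc)
    qed
  qed
  then have "level c \<phi>0" using M(2) by (simp add: level_def)
  then obtain x t where x: "x \<in> X" and t: "t \<le> c" "\<phi>0 x \<le> t"
    and lev: "level (c - t) (\<lambda>y\<in>X. \<delta> y {x})"
    using level_point[OF assms(1) c(2)] by metis
  have tfin: "t \<noteq> \<infinity>" using t(1) c(2) by auto
  show thesis
  \<comment> \<open>The witness for \<open>k\<close> is \<open>c - t\<close>, the level obtained for
    the distance to \<open>x\<close>.\<close>
  proof (rule that[OF x])
    show "u x < \<infinity>" using M(1) M(3)[OF x] by (auto simp: less_top)
    have "t + (c - t + \<Lambda> u) = M"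
      unfolding add.assoc[symmetric] add_diff_inverse_ennreal[OF t(1)] by (rule c(1))
    also have "M \<le> t + u x" using M(3)[OF x] t(2) by (metis add.commute add_left_mono)
    finally show "c - t + \<Lambda> u \<le> u x" using tfin by (simp add: ennreal_add_left_cancel_le)
  next
    fix v assume v: "v \<in> UX"
    show "v x \<le> c - t + \<Lambda> v"
    proof (rule dense_le)
      fix s assume s: "s < v x"
      have sfin: "s < \<infinity>" using less_le_trans[OF s top_greatest] by simp
      let ?d = "dual s (\<lambda>y\<in>X. \<delta> y {x})"
      \<comment> \<open>The truncated cone \<open>?d\<close> with peak \<open>s\<close> at
        \<open>x\<close> lies below \<open>v\<close>, because \<open>v y\<close> is at least
        \<open>v x\<close> minus \<open>\<delta> y {x}\<close>.\<close>
      have "\<Lambda> ?d \<le> \<Lambda> v"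
      proof (rule filter_fun_mono[OF _ v])
        show "?d \<in> UX" by (intro dual_upper_regular lower_regular_delta x sfin)
        fix y assume y: "y \<in> X"
        have "s \<le> v y + \<delta> y {x}" using s upper_regular_delta[OF v y x] by simp
        then show "?d y \<le> v y" using y by (simp add: dual_def ominus_le_iff add.commute)
      qed
      moreover have "s \<le> c - t + \<Lambda> ?d" using lev sfin by (simp add: level_def)
      ultimately show "s \<le> c - t + \<Lambda> v" by (meson add_left_mono order_trans)
    qed
  qed
qed

text \<open>The supremum defining \<open>\<nu>\<close> makes
  \<open>rho X \<nu> v \<le> \<Lambda> v\<close> automatic. For the converse,
  \<open>point_below\<close> gives a point where \<open>k\<close> bounds \<open>\<nu>\<close> and
  \<open>v\<close> is at least \<open>k + \<Lambda> v\<close>.\<close>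

lemma decent_representation:
  assumes sober: "sober X \<delta>"
    and decent: "u0 \<in> UX" "u0 \<noteq> const_fun X \<infinity>" "\<Lambda> u0 \<noteq> 0"
  obtains \<nu> where "saturated_fun X \<delta> \<nu>" "\<Lambda> = rho_from X \<delta> \<nu>"
proof -
  define \<nu> where "\<nu> = (\<lambda>x\<in>X. SUP v\<in>UX. v x \<ominus> \<Lambda> v)"
  have le: "v x \<le> \<nu> x + \<Lambda> v" if "x \<in> X" "v \<in> UX" for x v
  proof -
    have "v x \<ominus> \<Lambda> v \<le> \<nu> x" using that by (auto simp: \<nu>_def intro: SUP_upper)
    then show ?thesis by (simp add: ominus_le_iff add.commute)
  qed
  have \<nu>_le: "\<nu> x \<le> k" if "x \<in> X" "\<And>v. v \<in> UX \<Longrightarrow> v x \<le> k + \<Lambda> v" for x k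
    using that by (auto simp: \<nu>_def ominus_le_iff add.commute intro!: SUP_least)
  have "saturated_fun X \<delta> \<nu>"
    unfolding saturated_fun_def
  proof (intro conjI ballI)
    show "\<nu> \<in> X \<rightarrow>\<^sub>E UNIV" by (simp add: \<nu>_def)
    fix x y assume x: "x \<in> X" and y: "y \<in> X"
    show "\<nu> y \<le> \<delta> x {y} + \<nu> x"
    proof (rule \<nu>_le[OF y])
      fix v assume v: "v \<in> UX"
      have "v y \<le> v x + \<delta> x {y}" by (rule upper_regular_delta[OF v x y])
      also have "\<dots> \<le> \<nu> x + \<Lambda> v + \<delta> x {y}" by (intro add_right_mono le x v)
      finally show "v y \<le> \<delta> x {y} + \<nu> x + \<Lambda> v" by (simp add: ac_simps)
    qed
  qed
  moreover have "\<Lambda> v = rho X \<nu> v" if v: "v \<in> UX" for v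
  proof (rule antisym)
    show "rho X \<nu> v \<le> \<Lambda> v" using le[OF _ v] by (simp add: rho_le_iff)
    show "\<Lambda> v \<le> rho X \<nu> v"
    proof (cases "v = const_fun X \<infinity>")
      case True
      \<comment> \<open>Decency yields a point where \<open>\<nu>\<close> is finite; there the
        constant \<infinity> is infinitely far above \<open>\<nu>\<close>.\<close>
      have "0 < \<Lambda> u0" using decent(3) by (simp add: zero_less_iff_neq_zero)
      then obtain x k where x: "x \<in> X" "u0 x < \<infinity>" "k + \<Lambda> u0 \<le> u0 x"
        "\<And>v. v \<in> UX \<Longrightarrow> v x \<le> k + \<Lambda> v"
        using point_below[OF sober decent(1,2)] by metis
      have "k \<le> k + \<Lambda> u0" by simp
      then have "k < \<infinity>" using x(2,3) by (meson le_less_trans)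
      then have "\<nu> x < \<infinity>" using \<nu>_le[OF x(1,4)] by (auto intro: le_less_trans)
      moreover have "v x \<le> \<nu> x + rho X \<nu> v" by (rule le_add_rho[OF x(1)])
      ultimately have "rho X \<nu> v = \<infinity>"
        using True x(1) by (auto simp: const_fun_def top_unique)
      then show ?thesis by simp
    next
      case False
      show ?thesis
      proof (cases "\<Lambda> v = 0")
        case False
        then have "0 < \<Lambda> v" by (simp add: zero_less_iff_neq_zero)
        then obtain x k where x: "x \<in> X" "v x < \<infinity>" "k + \<Lambda> v \<le> v x"
          "\<And>w. w \<in> UX \<Longrightarrow> w x \<le> k + \<Lambda> w"
          using point_below[OF sober v \<open>v \<noteq> const_fun X \<infinity>\<close>] by metis
        \<comment> \<open>Both sides are compared through \<open>v x\<close>, using that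
          \<open>\<nu> x\<close> is at most \<open>k\<close>; finiteness of \<open>k\<close> then
          permits cancellation.\<close>
        have "k + \<Lambda> v \<le> k + rho X \<nu> v"
          using x(3) le_add_rho[OF x(1), of v \<nu>] \<nu>_le[OF x(1,4)]
          by (meson add_right_mono order_trans)
        moreover have "k \<noteq> \<infinity>" using x(2,3) by auto
        ultimately show ?thesis by (simp add: ennreal_add_left_cancel_le)
      qed simp
    qed
  qed
  moreover have "\<Lambda> \<in> UX \<rightarrow>\<^sub>E UNIV"
    using is_filter by (simp add: is_filter_def is_ideal_def weight_def)
  ultimately show thesis
    by (intro that) (auto simp: rho_from_def PiE_def intro!: extensionalityI[of \<Lambda> UX])
qed

end

section \<open>Properness and decency, bijections and isometries\<close>

context approach
begin

text \<open>Compactness supplies the filter, so only constants matter. At a finite constant the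
  value is given by \<open>rho_const_fun\<close>, and the constant \<infinity> is approximated from
  below; conversely, the constant 1 alone forces the infimum of \<open>\<theta>\<close> to be
  0.\<close>

lemma inhabited_iff_proper:
  assumes "compact_fun X \<delta> \<theta>"
  shows "inhabited_fun X \<theta> \<longleftrightarrow> proper_filter X \<delta> (rho_from X \<delta> \<theta>)"
proof
  assume inh: "inhabited_fun X \<theta>"
  have fin: "rho X \<theta> (const_fun X r) = r" if "r < \<infinity>" for r
    using inh rho_const_fun[OF that, of X \<theta>] that
    by (simp add: inhabited_fun_def ominus_eq_minus)
  have "rho X \<theta> (const_fun X r) = r" for r
  proof (cases "r = \<infinity>")
    case True
    have "\<infinity> \<le> rho X \<theta> (const_fun X \<infinity>)"
    proof (rule dense_le)
      fix s :: ennreal assume s: "s < \<infinity>"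
      have "rho X (const_fun X \<infinity>) (const_fun X s) = 0"
        by (rule rho_eq_0) (simp add: const_fun_def)
      then show "s \<le> rho X \<theta> (const_fun X \<infinity>)"
        using rho_triangle[of X \<theta> "const_fun X s" "const_fun X \<infinity>"] fin[OF s] by simp
    qed
    then show ?thesis using True by (simp add: top_unique)
  qed (simp add: fin less_top)
  then show "proper_filter X \<delta> (rho_from X \<delta> \<theta>)"
    using assms const_fun_upper_regular
    by (simp add: proper_filter_def compact_fun_def open_filter_def rho_from_def)
next
  assume "proper_filter X \<delta> (rho_from X \<delta> \<theta>)"
  then have "rho X \<theta> (const_fun X 1) = 1"
    using const_fun_upper_regular by (simp add: proper_filter_def rho_from_def)
  then have eq: "1 \<ominus> (INF x\<in>X. \<theta> x) = 1" by (simp add: rho_const_fun)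
  have "(INF x\<in>X. \<theta> x) = 0"
  proof (rule ccontr)
    assume "(INF x\<in>X. \<theta> x) \<noteq> 0"
    then have "1 \<ominus> (INF x\<in>X. \<theta> x) < 1"
      by (auto simp: ominus_def zero_less_iff_neq_zero intro: ennreal_between)
    then show False using eq by simp
  qed
  then show "inhabited_fun X \<theta>" by (simp add: inhabited_fun_def)
qed

text \<open>A finite constant above some finite value of \<open>\<theta>\<close> witnesses decency;
  conversely, distances from the constant \<infinity> all vanish.\<close>

lemma nonvacuous_iff_decent:
  assumes "compact_fun X \<delta> \<theta>"
  shows "\<not> vacuous_fun X \<theta> \<longleftrightarrow> decent_filter X \<delta> (rho_from X \<delta> \<theta>)"
proof
  assume "\<not> vacuous_fun X \<theta>"
  moreover have "\<theta> \<in> extensional X" using assms by (simp add: compact_fun_def PiE_def)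
  ultimately obtain x where x: "x \<in> X" "\<theta> x < \<infinity>"
    unfolding vacuous_fun_def const_fun_def
    by (metis extensionalityI infinity_ennreal_def less_top restrict_apply' restrict_extensional)
  then obtain r where r: "\<theta> x < r" "r < \<infinity>" using dense by blast
  have "const_fun X r x \<le> \<theta> x + rho X \<theta> (const_fun X r)" by (rule le_add_rho[OF x(1)])
  then have "rho X \<theta> (const_fun X r) \<noteq> 0" using x(1) r(1) by (auto simp: const_fun_def)
  moreover have "const_fun X r \<noteq> const_fun X \<infinity>"
    using x(1) r(2) by (auto simp: const_fun_def dest: fun_cong[of _ _ x])
  ultimately show "decent_filter X \<delta> (rho_from X \<delta> \<theta>)"
    using assms const_fun_upper_regular[of r]
    by (auto simp: decent_filter_def compact_fun_def open_filter_def rho_from_def)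
next
  assume "decent_filter X \<delta> (rho_from X \<delta> \<theta>)"
  then obtain u where "rho X \<theta> u \<noteq> 0" by (auto simp: decent_filter_def rho_from_def)
  moreover have "rho X (const_fun X \<infinity>) u = 0" by (rule rho_eq_0) (simp add: const_fun_def)
  ultimately show "\<not> vacuous_fun X \<theta>" by (auto simp: vacuous_fun_def)
qed

text \<open>The witness is the constant 1. On an empty \<open>X\<close> it would coincide with the
  constant \<infinity>, but \<open>\<Lambda>\<close> takes different values on the two.\<close>

lemma proper_imp_decent:
  assumes "proper_filter X \<delta> \<Lambda>"
  shows "decent_filter X \<delta> \<Lambda>"
proof -
  have \<Lambda>: "\<Lambda> (const_fun X r) = r" for r using assms by (simp add: proper_filter_def)
  have "const_fun X 1 \<noteq> const_fun X \<infinity>"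
    using \<Lambda>[of 1] \<Lambda>[of \<infinity>] by (metis ennreal_one_neq_top infinity_ennreal_def)
  then show ?thesis
    using assms const_fun_upper_regular[of 1] \<Lambda>[of 1]
    by (auto simp: decent_filter_def proper_filter_def)
qed

text \<open>Surjectivity is \<open>decent_representation\<close>; compactness of
  \<open>\<nu>\<close> is the openness of \<open>\<Lambda>\<close> read through the
  representation.\<close>

lemma rho_from_image_decent:
  assumes "sober X \<delta>"
  shows "rho_from X \<delta> ` nonvacuous_compact_saturated X \<delta> = decent_open_filters X \<delta>"
proof
  show "rho_from X \<delta> ` nonvacuous_compact_saturated X \<delta> \<subseteq> decent_open_filters X \<delta>"
    using nonvacuous_iff_decent
    by (auto simp: nonvacuous_compact_saturated_def decent_open_filters_def compact_fun_def)
  show "decent_open_filters X \<delta> \<subseteq> rho_from X \<delta> ` nonvacuous_compact_saturated X \<delta>"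
  proof
    fix \<Lambda> assume \<Lambda>: "\<Lambda> \<in> decent_open_filters X \<delta>"
    interpret approach_open_filter X \<delta> \<Lambda>
      using \<Lambda> by unfold_locales (simp add: decent_open_filters_def)
    obtain u where "u \<in> UX" "u \<noteq> const_fun X \<infinity>" "\<Lambda> u \<noteq> 0"
      using \<Lambda> by (auto simp: decent_open_filters_def decent_filter_def)
    then obtain \<nu> where \<nu>: "saturated_fun X \<delta> \<nu>" "\<Lambda> = rho_from X \<delta> \<nu>"
      using decent_representation[OF assms] by metis
    have "compact_fun X \<delta> \<nu>"
      using \<nu> open_filter by (simp add: compact_fun_def saturated_fun_def)
    then show "\<Lambda> \<in> rho_from X \<delta> ` nonvacuous_compact_saturated X \<delta>"
      using \<nu> \<Lambda> nonvacuous_iff_decent[of \<nu>]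
      by (auto simp: nonvacuous_compact_saturated_def decent_open_filters_def)
  qed
qed

text \<open>A proper filter is decent and so already represented; properness then makes the
  representing function inhabited.\<close>

lemma rho_from_image_proper:
  assumes "sober X \<delta>"
  shows "rho_from X \<delta> ` inhabited_compact_saturated X \<delta> = proper_open_filters X \<delta>"
proof
  show "rho_from X \<delta> ` inhabited_compact_saturated X \<delta> \<subseteq> proper_open_filters X \<delta>"
    using inhabited_iff_proper
    by (auto simp: inhabited_compact_saturated_def proper_open_filters_def compact_fun_def)
  show "proper_open_filters X \<delta> \<subseteq> rho_from X \<delta> ` inhabited_compact_saturated X \<delta>"
  proof
    fix \<Lambda> assume \<Lambda>: "\<Lambda> \<in> proper_open_filters X \<delta>"
    then have "\<Lambda> \<in> decent_open_filters X \<delta>"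
      using proper_imp_decent by (simp add: proper_open_filters_def decent_open_filters_def)
    then obtain \<nu> where "\<nu> \<in> nonvacuous_compact_saturated X \<delta>" "\<Lambda> = rho_from X \<delta> \<nu>"
      using rho_from_image_decent[OF assms] by blast
    then show "\<Lambda> \<in> rho_from X \<delta> ` inhabited_compact_saturated X \<delta>"
      using \<Lambda> inhabited_iff_proper[of \<nu>]
      by (auto simp: nonvacuous_compact_saturated_def inhabited_compact_saturated_def
          proper_open_filters_def)
  qed
qed

text \<open>Injectivity and the distance formula come from saturation, so the inhabited and the
  non-vacuous case differ only in their images.\<close>

lemma metric_iso_rho_from:
  assumes sat: "\<And>\<theta>. \<theta> \<in> P \<Longrightarrow> saturated_fun X \<delta> \<theta>" and image: "rho_from X \<delta> ` P = Q"
  shows "metric_iso P (op_metric (rho X)) Q (rho UX) (rho_from X \<delta>)"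
  unfolding metric_iso_def
proof (intro conjI ballI)
  show "is_metric P (op_metric (rho X))"
    by (auto simp: is_metric_def op_metric_def) (metis add.commute rho_triangle)
  show "is_metric Q (rho UX)" by (rule is_metric_rho)
  show "bij_betw (rho_from X \<delta>) P Q"
    unfolding bij_betw_def
  proof (intro conjI image inj_onI)
    fix \<theta> \<eta> assume "\<theta> \<in> P" "\<eta> \<in> P" and eq: "rho_from X \<delta> \<theta> = rho_from X \<delta> \<eta>"
    then show "\<theta> = \<eta>"
      using sat fun_cong[OF eq] by (intro saturated_eqI) (metis rho_from_def restrict_apply')+
  qed
  show "op_metric (rho X) \<theta> \<eta> = rho UX (rho_from X \<delta> \<theta>) (rho_from X \<delta> \<eta>)"
    if "\<theta> \<in> P" for \<theta> \<eta>
    unfolding op_metric_def by (rule rho_rho_from[OF sat[OF that]])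
qed

text \<open>Existence is membership in the image, and uniqueness is
  \<open>saturated_eqI\<close>.\<close>

lemma unique_representation:
  assumes sat: "\<And>\<theta>. \<theta> \<in> P \<Longrightarrow> saturated_fun X \<delta> \<theta>" and \<Lambda>: "\<Lambda> \<in> rho_from X \<delta> ` P"
  shows "\<exists>!\<nu>. \<nu> \<in> P \<and> (\<forall>l\<in>UX. \<Lambda> l = rho X \<nu> l)"
proof -
  obtain \<nu> where \<nu>: "\<nu> \<in> P" "\<forall>l\<in>UX. \<Lambda> l = rho X \<nu> l"
    using \<Lambda> by (auto simp: rho_from_def)
  moreover have "\<mu> = \<nu>" if "\<mu> \<in> P" "\<forall>l\<in>UX. \<Lambda> l = rho X \<mu> l" for \<mu>
    using that \<nu> sat by (intro saturated_eqI) auto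
  ultimately show ?thesis by blast
qed

end

theorem theorem4p6:
  fixes X :: "'a set" and \<delta> :: "'a \<Rightarrow> 'a set \<Rightarrow> ennreal"
  assumes "approach_space X \<delta>" and "sober X \<delta>"
  shows
    "(\<forall>\<Lambda> \<in> proper_open_filters X \<delta>.
        \<exists>!\<nu>. \<nu> \<in> inhabited_compact_saturated X \<delta> \<and>
             (\<forall>l \<in> upper_regular X \<delta>. \<Lambda> l = rho X \<nu> l)) \<and>
     (\<forall>\<Lambda> \<in> decent_open_filters X \<delta>.
        \<exists>!\<mu>. \<mu> \<in> nonvacuous_compact_saturated X \<delta> \<and>
             (\<forall>l \<in> upper_regular X \<delta>. \<Lambda> l = rho X \<mu> l)) \<and>
     bij_betw (rho_from X \<delta>) (inhabited_compact_saturated X \<delta>) (proper_open_filters X \<delta>) \<and>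
     bij_betw (rho_from X \<delta>) (nonvacuous_compact_saturated X \<delta>) (decent_open_filters X \<delta>) \<and>
     metric_iso (inhabited_compact_saturated X \<delta>) (op_metric (rho X))
                (proper_open_filters X \<delta>) (rho (upper_regular X \<delta>)) (rho_from X \<delta>) \<and>
     metric_iso (nonvacuous_compact_saturated X \<delta>) (op_metric (rho X))
                (decent_open_filters X \<delta>) (rho (upper_regular X \<delta>)) (rho_from X \<delta>) \<and>
     (\<forall>\<theta> \<in> inhabited_compact_saturated X \<delta>. \<forall>\<eta> \<in> inhabited_compact_saturated X \<delta>.
        rho X \<theta> \<eta> = rho (upper_regular X \<delta>) (rho_from X \<delta> \<eta>) (rho_from X \<delta> \<theta>)) \<and>
     (\<forall>\<theta> \<in> nonvacuous_compact_saturated X \<delta>. \<forall>\<eta> \<in> nonvacuous_compact_saturated X \<delta>.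
        rho X \<theta> \<eta> = rho (upper_regular X \<delta>) (rho_from X \<delta> \<eta>) (rho_from X \<delta> \<theta>))"
proof -
  interpret approach X \<delta> using assms(1) by unfold_locales
  have sat: "saturated_fun X \<delta> \<theta>"
    if "\<theta> \<in> inhabited_compact_saturated X \<delta> \<or> \<theta> \<in> nonvacuous_compact_saturated X \<delta>" for \<theta>
    using that by (auto simp: inhabited_compact_saturated_def nonvacuous_compact_saturated_def)
  note image = rho_from_image_proper[OF assms(2)] rho_from_image_decent[OF assms(2)]
  have iso: "metric_iso (inhabited_compact_saturated X \<delta>) (op_metric (rho X))
      (proper_open_filters X \<delta>) (rho UX) (rho_from X \<delta>)"
    "metric_iso (nonvacuous_compact_saturated X \<delta>) (op_metric (rho X))
      (decent_open_filters X \<delta>) (rho UX) (rho_from X \<delta>)"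
    using metric_iso_rho_from[OF _ image(1)] metric_iso_rho_from[OF _ image(2)] sat by blast+
  show ?thesis
  proof (intro conjI ballI iso)
    show "\<exists>!\<nu>. \<nu> \<in> inhabited_compact_saturated X \<delta> \<and> (\<forall>l\<in>UX. \<Lambda> l = rho X \<nu> l)"
      if "\<Lambda> \<in> proper_open_filters X \<delta>" for \<Lambda>
      using that sat by (intro unique_representation) (auto simp: image)
    show "\<exists>!\<mu>. \<mu> \<in> nonvacuous_compact_saturated X \<delta> \<and> (\<forall>l\<in>UX. \<Lambda> l = rho X \<mu> l)"
      if "\<Lambda> \<in> decent_open_filters X \<delta>" for \<Lambda>
      using that sat by (intro unique_representation) (auto simp: image)
  qed (use iso sat rho_rho_from in \<open>auto simp: metric_iso_def\<close>)
qed

end
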